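(* Let $\mathcal{H}$ be a complex Hilbert space and let $T$ be a bounded linear operator on $\mathcal{H}$ that is absolute-$(p,r)$-paranormal for some real numbers $p,r>0$. If $T^2$ is compact, then $T$ is compact.
   Context: For a bounded linear operator $T$ on a complex Hilbert space $\mathcal{H}$, $|T|=(T^*T)^{1/2}$ and $|T^*|=(TT^* )^{1/2}$; real positive powers of positive operators are defined by functional calculus. For $p,r>0$, $T$ is called absolute-$(p,r)$-paranormal if $\| |T|^p |T^*|^r x \|^r \geq \| |T^*|^r x \|^{p+r}$ for every unit vector $x\in\mathcal{H}$ (equivalently, $\| |T|^p |T^*|^r x \|^r\|x\|^p \geq \| |T^*|^r x \|^{p+r}$ for all $x\in\mathcal{H}$). *)

theory Defs
  imports "HOL-Analysis.Analysis" "HOL-Computational_Algebra.Polynomial"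
begin

text \<open>
  Complex inner product spaces, built on the real inner product spaces of the library: the real
  inner product is the real part of the complex one, so both induce the same norm and topology.
  The complex inner product is linear in its first argument.
\<close>

class complex_inner = real_inner +
  fixes scaleC :: "complex \<Rightarrow> 'a \<Rightarrow> 'a" (infixr "*\<^sub>C" 75)
    and cinner :: "'a \<Rightarrow> 'a \<Rightarrow> complex"
  assumes scaleC_add_right: "c *\<^sub>C (x + y) = c *\<^sub>C x + c *\<^sub>C y"
    and scaleC_add_left: "(c + d) *\<^sub>C x = c *\<^sub>C x + d *\<^sub>C x"
    and scaleC_scaleC: "c *\<^sub>C (d *\<^sub>C x) = (c * d) *\<^sub>C x"
    and scaleR_scaleC: "scaleR a x = complex_of_real a *\<^sub>C x"
    and cinner_commute: "cinner x y = cnj (cinner y x)"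
    and cinner_add_left: "cinner (x + y) z = cinner x z + cinner y z"
    and cinner_scaleC_left: "cinner (c *\<^sub>C x) y = c * cinner x y"
    and inner_eq_Re_cinner: "inner x y = Re (cinner x y)"

class chilbert_space = complex_inner + complete_space

definition bounded_clinear :: "('a::complex_inner \<Rightarrow> 'b::complex_inner) \<Rightarrow> bool" where
  "bounded_clinear T \<longleftrightarrow> bounded_linear T \<and> (\<forall>c x. T (c *\<^sub>C x) = c *\<^sub>C T x)"

definition cadjoint :: "('a::chilbert_space \<Rightarrow> 'a) \<Rightarrow> ('a \<Rightarrow> 'a)" where
  "cadjoint T = (THE S. bounded_clinear S \<and> (\<forall>x y. cinner (T x) y = cinner x (S y)))"

definition op_spectrum :: "('a::chilbert_space \<Rightarrow> 'a) \<Rightarrow> complex set" where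
  "op_spectrum A = {z. \<not> (\<exists>R. bounded_clinear R \<and>
     (\<forall>x. R (A x - z *\<^sub>C x) = x) \<and> (\<forall>x. A (R x) - z *\<^sub>C R x = x))}"

definition op_poly :: "complex poly \<Rightarrow> ('a::chilbert_space \<Rightarrow> 'a) \<Rightarrow> ('a \<Rightarrow> 'a)" where
  "op_poly P A x = (\<Sum>i\<le>degree P. coeff P i *\<^sub>C (A ^^ i) x)"

text \<open>
  Continuous functional calculus of a self-adjoint operator \<open>A\<close>: \<open>f(A)\<close> is the limit in operator
  norm of \<open>P\<^sub>n(A)\<close>, where the polynomials \<open>P\<^sub>n\<close> converge to \<open>f\<close> uniformly on the spectrum of \<open>A\<close>.
  It is meant only for self-adjoint \<open>A\<close> and \<open>f\<close> continuous on the spectrum.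
\<close>

definition op_cfc :: "(complex \<Rightarrow> complex) \<Rightarrow> ('a::chilbert_space \<Rightarrow> 'a) \<Rightarrow> ('a \<Rightarrow> 'a)" where
  "op_cfc f A = (THE B. bounded_clinear B \<and>
     (\<exists>P :: nat \<Rightarrow> complex poly.
        uniform_limit (op_spectrum A) (\<lambda>n z. poly (P n) z) f sequentially \<and>
        (\<lambda>n. onorm (\<lambda>x. op_poly (P n) A x - B x)) \<longlonglongrightarrow> 0))"

text \<open>
  Powers \<open>A\<^sup>s\<close>, \<open>s > 0\<close>, of a positive operator. The spectrum of \<open>A\<close> lies in \<open>[0,\<infinity>)\<close>, where
  \<open>Re z = z\<close>; note that \<open>0 powr s = 0\<close>.
\<close>

definition op_powr :: "('a::chilbert_space \<Rightarrow> 'a) \<Rightarrow> real \<Rightarrow> ('a \<Rightarrow> 'a)" where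
  "op_powr A s = op_cfc (\<lambda>z. complex_of_real (Re z powr s)) A"

definition op_abs :: "('a::chilbert_space \<Rightarrow> 'a) \<Rightarrow> ('a \<Rightarrow> 'a)" where
  "op_abs T = op_powr (cadjoint T \<circ> T) (1 / 2)"

text \<open>\<open>|T\<^sup>*| = (T T\<^sup>*)\<^bsup>1/2\<^esup>\<close> is rendered as the absolute value of the adjoint, using \<open>T\<^sup>*\<^sup>* = T\<close>.\<close>

definition absolute_paranormal :: "real \<Rightarrow> real \<Rightarrow> ('a::chilbert_space \<Rightarrow> 'a) \<Rightarrow> bool" where
  "absolute_paranormal p r T \<longleftrightarrow>
     (\<forall>x. norm x = 1 \<longrightarrow>
        norm (op_powr (op_abs T) p (op_powr (op_abs (cadjoint T)) r x)) powr r
          \<ge> norm (op_powr (op_abs (cadjoint T)) r x) powr (p + r))"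

definition compact_operator :: "('a::chilbert_space \<Rightarrow> 'a) \<Rightarrow> bool" where
  "compact_operator T \<longleftrightarrow> bounded_clinear T \<and> (\<forall>S. bounded S \<longrightarrow> compact (closure (T ` S)))"

end

theory Submission
  imports Defs "HOL-Computational_Algebra.Fundamental_Theorem_Algebra"
begin

text \<open>
  Write \<open>|T|\<close> for \<open>op_abs T\<close>. The inequality bounds \<open>|T\<^sup>*|\<^sup>r x\<close> by \<open>|T|\<^sup>p |T\<^sup>*|\<^sup>r x\<close> and \<open>x\<close>
  (\<open>absolute_paranormal_homogeneous\<close>). Applied to differences of points of a bounded set it shows
  that \<open>|T\<^sup>*|\<^sup>r\<close> is compact as soon as \<open>|T|\<^sup>p |T\<^sup>*|\<^sup>r\<close> is
  (\<open>compact_operator_interpolation\<close>). So two changes of exponent remain.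

  First, compactness of \<open>T\<^sup>2\<close> gives compactness of \<open>T\<^sup>* T\<^sup>2 T\<^sup>*\<close>, which is
  \<open>|T|\<^sup>2 |T\<^sup>*|\<^sup>2\<close>; the exponents 2 have to be replaced by \<open>p\<close> and \<open>r\<close>. Secondly, from \<open>|T\<^sup>*|\<^sup>r\<close>
  one has to return to \<open>|T\<^sup>*|\<^sup>2 = T T\<^sup>*\<close>. Both rest on one fact about a positive operator \<open>A\<close>: for
  all \<open>s, t > 0\<close> the function \<open>x powr t\<close> is a uniform limit on the spectrum of functions
  \<open>q x * x powr s\<close> with polynomials \<open>q\<close>, so that \<open>A\<^sup>t\<close> is a norm limit of operators
  \<open>q(A) A\<^sup>s\<close> (\<open>op_powr_approx_multiple\<close>). As the compact operators form a norm-closed ideal,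
  exponents may be exchanged freely. Since \<open>|T|\<close> is the power \<open>1/2\<close> of \<open>T\<^sup>* T\<close>, the exchange
  is made once for \<open>T\<^sup>* T\<close> and once for \<open>|T|\<close>, and likewise for \<open>T\<^sup>*\<close>. Finally
  \<open>norm (S x)\<^sup>2 \<le> norm (S\<^sup>* (S x)) * norm x\<close> takes compactness from \<open>S\<^sup>* S\<close> to \<open>S\<close>, first for
  \<open>S = T\<^sup>*\<close> and then for \<open>S = T\<close>, since \<open>T\<^sup>* T\<close> is compact once \<open>T\<^sup>*\<close> is.

  The functional calculus rests on the estimate \<open>norm_op_poly_le\<close>: \<open>P(A)\<close> is bounded by the supremum
  of \<open>|P|\<close> on the spectrum. With \<open>m = onorm (P(A))\<close>, the operator \<open>P(A)\<^sup>* P(A) - m\<^sup>2\<close> is not bounded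
  below; it is a polynomial in \<open>A\<close>, hence a product of factors \<open>A - z\<close>, and for one of the roots
  \<open>z\<close> the factor is not bounded below either. That \<open>z\<close> is a real spectral value with
  \<open>|P(z)| = m\<close>.
\<close>

section \<open>Complex inner product spaces\<close>

lemma scaleC_one [simp]: "1 *\<^sub>C (x::'a::complex_inner) = x"
  using scaleR_scaleC[of 1 x] by simp

lemma scaleC_zero_left [simp]: "0 *\<^sub>C (x::'a::complex_inner) = 0"
  using scaleR_scaleC[of 0 x] by simp

lemma scaleC_zero_right [simp]: "c *\<^sub>C (0::'a::complex_inner) = 0"
  using scaleC_add_right[of c "0::'a" 0] by simp

lemma scaleC_minus_left: "(- c) *\<^sub>C (x::'a::complex_inner) = - (c *\<^sub>C x)"
  using scaleC_add_left[of "- c" c x] by (simp add: eq_neg_iff_add_eq_0)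

lemma scaleC_minus_right: "c *\<^sub>C (- x::'a::complex_inner) = - (c *\<^sub>C x)"
  using scaleC_add_right[of c "- x" x] by (simp add: eq_neg_iff_add_eq_0)

lemma scaleC_diff_right: "c *\<^sub>C (x - y::'a::complex_inner) = c *\<^sub>C x - c *\<^sub>C y"
  using scaleC_add_right[of c x "- y"] by (simp add: scaleC_minus_right)

lemma cinner_scaleC_right: "cinner (x::'a::complex_inner) (c *\<^sub>C y) = cnj c * cinner x y"
  by (metis cinner_commute cinner_scaleC_left complex_cnj_cnj complex_cnj_mult)

lemma inner_scaleC_left: "inner (c *\<^sub>C (x::'a::complex_inner)) y = inner x (cnj c *\<^sub>C y)"
  by (simp add: inner_eq_Re_cinner cinner_scaleC_left cinner_scaleC_right)

lemma norm_scaleC: "norm (c *\<^sub>C (x::'a::complex_inner)) = cmod c * norm x"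
proof -
  have "(norm (c *\<^sub>C x))\<^sup>2 = inner x (cnj c *\<^sub>C (c *\<^sub>C x))"
    by (simp add: power2_norm_eq_inner inner_scaleC_left)
  also have "cnj c *\<^sub>C (c *\<^sub>C x) = scaleR ((cmod c)\<^sup>2) x"
    by (simp only: scaleC_scaleC scaleR_scaleC complex_norm_square mult.commute)
  also have "inner x (scaleR ((cmod c)\<^sup>2) x) = (cmod c * norm x)\<^sup>2"
    by (simp add: power_mult_distrib power2_norm_eq_inner)
  finally show ?thesis
    by (simp add: power2_eq_iff_nonneg)
qed

lemma inner_eq_imp_eq:
  fixes u v :: "'a::real_inner"
  assumes "\<And>x. inner x u = inner x v"
  shows "u = v"
proof -
  have "inner (u - v) (u - v) = 0"
    using assms[of "u - v"] by (simp add: inner_diff_right)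
  then show ?thesis by simp
qed

text \<open>
  Adjointness may be tested on the real inner product alone: the imaginary part of
  \<open>cinner\<close> is recovered by replacing \<open>x\<close> with \<open>\<i> x\<close>.
\<close>


lemma cinner_adjointI:
  fixes T S :: "'a::complex_inner \<Rightarrow> 'a"
  assumes "\<And>c x. T (c *\<^sub>C x) = c *\<^sub>C T x"
    and "\<And>x y. inner (T x) y = inner x (S y)"
  shows "cinner (T x) y = cinner x (S y)"
proof (rule complex_eqI)
  show "Re (cinner (T x) y) = Re (cinner x (S y))"
    using assms(2)[of x y] by (simp add: inner_eq_Re_cinner)
  show "Im (cinner (T x) y) = Im (cinner x (S y))"
    using assms(2)[of "\<i> *\<^sub>C x" y] by (simp add: assms(1) inner_eq_Re_cinner cinner_scaleC_left)
qed

section \<open>Bounded complex-linear operators\<close>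

lemma bounded_clinearI:
  assumes "\<And>x y. T (x + y) = T x + T y" and "\<And>c x. T (c *\<^sub>C x) = c *\<^sub>C T x"
    and "\<And>x. norm (T x) \<le> K * norm x"
  shows "bounded_clinear T"
  unfolding bounded_clinear_def
  using assms
  by (auto intro!: bounded_linear_intro[where K = K] simp: scaleR_scaleC mult.commute)

lemma bounded_clinear_bounded_linear: "bounded_clinear T \<Longrightarrow> bounded_linear T"
  by (simp add: bounded_clinear_def)

lemma bounded_clinear_scaleC: "bounded_clinear T \<Longrightarrow> T (c *\<^sub>C x) = c *\<^sub>C T x"
  by (simp add: bounded_clinear_def)

lemma bounded_clinear_add: "bounded_clinear T \<Longrightarrow> T (x + y) = T x + T y"
  by (simp add: bounded_clinear_def linear_add bounded_linear.linear)

lemma bounded_clinear_diff: "bounded_clinear T \<Longrightarrow> T (x - y) = T x - T y"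
  by (simp add: bounded_clinear_def linear_diff bounded_linear.linear)

lemma bounded_clinear_zero: "bounded_clinear T \<Longrightarrow> T 0 = 0"
  by (simp add: bounded_clinear_def linear_0 bounded_linear.linear)

lemma bounded_clinear_norm_le: "bounded_clinear T \<Longrightarrow> norm (T x) \<le> onorm T * norm x"
  by (simp add: bounded_clinear_def onorm)

lemma bounded_clinear_onorm_nonneg: "bounded_clinear T \<Longrightarrow> 0 \<le> onorm T"
  by (simp add: bounded_clinear_def onorm_pos_le)

lemma bounded_clinear_compose:
  "bounded_clinear S \<Longrightarrow> bounded_clinear T \<Longrightarrow> bounded_clinear (\<lambda>x. S (T x))"
  unfolding bounded_clinear_def by (auto intro: bounded_linear_compose)

lemma bounded_clinear_sub:
  "bounded_clinear S \<Longrightarrow> bounded_clinear T \<Longrightarrow> bounded_clinear (\<lambda>x. S x - T x)"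
  unfolding bounded_clinear_def by (auto intro: bounded_linear_sub simp: scaleC_diff_right)

lemma bounded_clinear_plus:
  "bounded_clinear S \<Longrightarrow> bounded_clinear T \<Longrightarrow> bounded_clinear (\<lambda>x. S x + T x)"
  unfolding bounded_clinear_def by (auto intro: bounded_linear_add simp: scaleC_add_right)

lemma bounded_clinear_id: "bounded_clinear (\<lambda>x. x)"
  by (rule bounded_clinearI[where K = 1]) auto

lemma bounded_clinear_scale: "bounded_clinear (\<lambda>x. c *\<^sub>C x)"
  by (rule bounded_clinearI[where K = "cmod c"])
     (auto simp: scaleC_add_right scaleC_scaleC norm_scaleC mult.commute)

text \<open>
  Minimising \<open>norm (L x)\<^sup>2 / 2 - f x\<close> solves the equation below: a minimising sequence is Cauchy
  by the parallelogram law, and the first variation vanishes at its limit. With \<open>L = id\<close> this is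
  the Riesz representation theorem; with \<open>L\<close> an adjoint that is bounded below it shows that the
  original operator is onto.
\<close>

lemma variational_solution:
  fixes L :: "'a::chilbert_space \<Rightarrow> 'a" and f :: "'a \<Rightarrow> real"
  assumes L: "bounded_linear L" and f: "bounded_linear f"
    and c: "c > 0" "\<And>x. c * norm x \<le> norm (L x)"
  shows "\<exists>y. \<forall>x. inner (L x) (L y) = f x"
proof -
  define J where "J = (\<lambda>x. (norm (L x))\<^sup>2 / 2 - f x)"
  define k where "k = onorm f / c"
  have k: "\<bar>f x\<bar> \<le> k * norm (L x)" for x
  proof -
    have "\<bar>f x\<bar> \<le> onorm f * norm x" using onorm[OF f, of x] by simp
    also have "\<dots> \<le> onorm f * (norm (L x) / c)"
      using c(2)[of x] c(1) onorm_pos_le[OF f]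
      by (intro mult_left_mono) (auto simp: field_simps)
    finally show ?thesis by (simp add: k_def)
  qed
  have low: "J x \<ge> - k\<^sup>2 / 2" for x
  proof -
    have "0 \<le> (norm (L x) - k)\<^sup>2" by simp
    then show ?thesis using k[of x] unfolding J_def by (simp add: power2_eq_square algebra_simps)
  qed
  define d where "d = Inf (range J)"
  have bdd: "bdd_below (range J)" unfolding bdd_below_def using low by blast
  have d: "d \<le> J x" for x unfolding d_def using bdd by (auto intro: cInf_lower)
  have "\<exists>x. J x < d + 1 / real (Suc n)" for n
  proof -
    have "Inf (range J) < d + 1 / real (Suc n)" unfolding d_def by simp
    from cInf_lessD[OF _ this] show ?thesis by auto
  qed
  then obtain u where u: "\<And>n. J (u n) < d + 1 / real (Suc n)" by metis
  have lin: "L (x + y) = L x + L y" "L (x - y) = L x - L y" "f (x + y) = f x + f y"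
      "L (a *\<^sub>R x) = a *\<^sub>R L x" "f (a *\<^sub>R x) = a * f x" for x y a
    using L f by (simp_all add: linear_add linear_diff linear_scale bounded_linear.linear)
  have par: "(norm (L (v - w)))\<^sup>2 \<le> 4 * (J v + J w - 2 * d)" for v w
  proof -
    have "(norm (L v - L w))\<^sup>2 = 4 * (J v + J w - 2 * J ((1/2) *\<^sub>R (v + w)))"
      unfolding J_def lin
      by (simp add: power2_norm_eq_inner inner_add_left inner_add_right inner_diff_left
            inner_diff_right inner_commute field_simps)
    then show ?thesis using d[of "(1/2) *\<^sub>R (v + w)"] lin by simp
  qed
  have "Cauchy u"
  proof (rule metric_CauchyI)
    fix e :: real assume e: "e > 0"
    obtain N where N: "8 / real (Suc N) < (c * e)\<^sup>2"
    proof -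
      have "(c * e)\<^sup>2 / 8 > 0" using e c by simp
      from reals_Archimedean[OF this] obtain N where "inverse (real (Suc N)) < (c * e)\<^sup>2 / 8" ..
      then show ?thesis using that[of N] by (simp add: field_simps)
    qed
    show "\<exists>M. \<forall>m\<ge>M. \<forall>n\<ge>M. dist (u m) (u n) < e"
    proof (intro exI allI impI)
      fix m n assume mn: "N \<le> m" "N \<le> n"
      have "1 / real (Suc m) \<le> 1 / real (Suc N)" "1 / real (Suc n) \<le> 1 / real (Suc N)"
        using mn by (auto intro!: divide_left_mono)
      then have "4 * (J (u m) + J (u n) - 2 * d) \<le> 8 / real (Suc N)"
        using u[of m] u[of n] by simp
      then have "(norm (L (u m - u n)))\<^sup>2 < (c * e)\<^sup>2"
        using par[of "u m" "u n"] N by linarith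
      then have "norm (L (u m - u n)) < c * e"
        using e c by (simp add: power2_less_imp_less)
      then have "c * norm (u m - u n) < c * e" using c(2)[of "u m - u n"] by linarith
      then show "dist (u m) (u n) < e" using c by (simp add: dist_norm)
    qed
  qed
  then obtain y where y: "u \<longlonglongrightarrow> y"
    using Cauchy_convergent convergent_def by blast
  have "(\<lambda>n. J (u n)) \<longlonglongrightarrow> J y"
    unfolding J_def
    by (intro tendsto_intros bounded_linear.tendsto[OF L] bounded_linear.tendsto[OF f] y) auto
  moreover have "(\<lambda>n. d + 1 / real (Suc n)) \<longlonglongrightarrow> d + 0"
    by (intro tendsto_intros LIMSEQ_Suc[OF lim_1_over_n])
  ultimately have "J y \<le> d + 0"
    by (rule LIMSEQ_le) (use u less_imp_le in blast)
  then have min: "J y \<le> J x" for x using d[of x] by simp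
  have "inner (L x) (L y) = f x" for x
  proof (cases "x = 0")
    case True
    then show ?thesis using L f by (simp add: linear_0 bounded_linear.linear)
  next
    case False
    then have nz: "norm (L x) > 0" using c(2)[of x] c(1)
      by (metis less_le_trans mult_pos_pos zero_less_norm_iff)
    define g where "g = f x - inner (L x) (L y)"
    define t where "t = g / (norm (L x))\<^sup>2"
    have "J (y + t *\<^sub>R x) = J y - t * g + t\<^sup>2 * (norm (L x))\<^sup>2 / 2"
      unfolding J_def g_def lin
      by (simp add: power2_norm_eq_inner inner_add_left inner_add_right inner_commute
           power2_eq_square[of t] field_simps)
    then have "t * g - t\<^sup>2 * (norm (L x))\<^sup>2 / 2 \<le> 0" using min[of "y + t *\<^sub>R x"] by simp
    moreover have "t\<^sup>2 * (norm (L x))\<^sup>2 = t * g"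
      using nz by (simp add: t_def power2_eq_square)
    ultimately have "t * g \<le> 0" by (simp add: mult.commute)
    then have "t * g * (norm (L x))\<^sup>2 \<le> 0" by (simp add: mult_nonpos_nonneg)
    moreover have "g\<^sup>2 = t * g * (norm (L x))\<^sup>2"
      using nz by (simp add: t_def power2_eq_square)
    ultimately have "g\<^sup>2 \<le> 0" by simp
    then show ?thesis by (simp add: g_def)
  qed
  then show ?thesis by blast
qed

section \<open>The adjoint\<close>

lemma ex_adjoint:
  fixes T :: "'a::chilbert_space \<Rightarrow> 'a"
  assumes T: "bounded_clinear T"
  shows "\<exists>S. bounded_clinear S \<and> (\<forall>x y. inner (T x) y = inner x (S y))"
proof -
  have "\<exists>s. \<forall>x. inner x s = inner (T x) y" for y
    using variational_solution[of "\<lambda>x. x" "\<lambda>x. inner (T x) y" 1]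
      bounded_linear_compose[OF bounded_linear_inner_left bounded_clinear_bounded_linear[OF T]]
    by auto
  then obtain S where S: "\<And>x y. inner x (S y) = inner (T x) y" by metis
  have "bounded_clinear S"
  proof (rule bounded_clinearI)
    show "S (x + y) = S x + S y" for x y
      by (rule inner_eq_imp_eq) (simp add: S inner_add_right)
    show "S (c *\<^sub>C x) = c *\<^sub>C S x" for c x
    proof (rule inner_eq_imp_eq)
      fix z
      have "inner z (c *\<^sub>C S x) = inner (cnj c *\<^sub>C z) (S x)" by (simp add: inner_scaleC_left)
      also have "\<dots> = inner z (S (c *\<^sub>C x))"
        by (simp add: S bounded_clinear_scaleC[OF T] inner_scaleC_left)
      finally show "inner z (S (c *\<^sub>C x)) = inner z (c *\<^sub>C S x)" by simp
    qed
    show "norm (S x) \<le> onorm T * norm x" for x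
    proof (cases "S x = 0")
      case True
      then show ?thesis using bounded_clinear_onorm_nonneg[OF T] by simp
    next
      case False
      have "norm (S x) * norm (S x) = inner (T (S x)) x"
        by (simp add: S[symmetric] power2_eq_square[symmetric] power2_norm_eq_inner)
      also have "\<dots> \<le> norm (T (S x)) * norm x" by (rule norm_cauchy_schwarz)
      also have "\<dots> \<le> (onorm T * norm (S x)) * norm x"
        by (intro mult_right_mono bounded_clinear_norm_le[OF T]) auto
      finally show ?thesis using False by (simp add: mult_ac)
    qed
  qed
  then show ?thesis using S by auto
qed

lemma cadjoint:
  fixes T :: "'a::chilbert_space \<Rightarrow> 'a"
  assumes T: "bounded_clinear T"
  shows bounded_clinear_cadjoint: "bounded_clinear (cadjoint T)"
    and inner_cadjoint_right: "inner x (cadjoint T y) = inner (T x) y"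
proof -
  obtain S where S: "bounded_clinear S" "\<And>x y. inner (T x) y = inner x (S y)"
    using ex_adjoint[OF T] by auto
  let ?P = "\<lambda>S. bounded_clinear S \<and> (\<forall>x y. cinner (T x) y = cinner x (S y))"
  have "cadjoint T = S"
    unfolding cadjoint_def
  proof (rule the_equality)
    show "?P S" using S cinner_adjointI[of T S] bounded_clinear_scaleC[OF T] by blast
    fix R assume "?P R"
    then have "inner x (R y) = inner x (S y)" for x y
      using S(2)[of x y] by (simp add: inner_eq_Re_cinner)
    then show "R = S" by (rule ext[OF inner_eq_imp_eq])
  qed
  then show "bounded_clinear (cadjoint T)" "inner x (cadjoint T y) = inner (T x) y"
    using S by auto
qed

lemma inner_cadjoint_left:
  "bounded_clinear T \<Longrightarrow> inner (cadjoint T x) y = inner x (T y)"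
  using inner_cadjoint_right[of T y x] by (simp add: inner_commute)

lemma cadjoint_cadjoint:
  assumes T: "bounded_clinear T"
  shows "cadjoint (cadjoint T) = T"
  by (rule ext[OF inner_eq_imp_eq])
     (simp add: inner_cadjoint_right[OF bounded_clinear_cadjoint[OF T]] inner_cadjoint_left[OF T])

section \<open>Positive operators and their spectrum\<close>

definition positive_op :: "('a::chilbert_space \<Rightarrow> 'a) \<Rightarrow> bool" where
  "positive_op A \<longleftrightarrow> bounded_clinear A \<and> (\<forall>x y. inner (A x) y = inner x (A y)) \<and>
     (\<forall>x. 0 \<le> inner (A x) x)"

definition bounded_below :: "('a::real_normed_vector \<Rightarrow> 'a) \<Rightarrow> bool" where
  "bounded_below L \<longleftrightarrow> (\<exists>c>0. \<forall>x. c * norm x \<le> norm (L x))"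

lemma positive_op_bounded_clinear: "positive_op A \<Longrightarrow> bounded_clinear A"
  by (simp add: positive_op_def)

lemma positive_op_symmetric: "positive_op A \<Longrightarrow> inner (A x) y = inner x (A y)"
  by (simp add: positive_op_def)

lemma positive_op_nonneg: "positive_op A \<Longrightarrow> 0 \<le> inner (A x) x"
  unfolding positive_op_def by blast

lemma positive_op_cadjoint_compose:
  assumes T: "bounded_clinear T"
  shows "positive_op (cadjoint T \<circ> T)"
  using bounded_clinear_compose[OF bounded_clinear_cadjoint[OF T] T]
  by (simp add: positive_op_def inner_cadjoint_left[OF T] inner_cadjoint_right[OF T] o_def)

lemma bounded_belowI:
  assumes "c > 0" and "\<And>x. c * norm x * norm x \<le> norm (L x) * norm x"
  shows "bounded_below L"
  unfolding bounded_below_def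
proof (intro exI conjI allI)
  show "c * norm x \<le> norm (L x)" for x
    using assms(2)[of x] by (cases "x = 0") auto
qed fact

lemma bounded_below_compose:
  assumes "bounded_below K" "bounded_below L"
  shows "bounded_below (\<lambda>x. K (L x))"
proof -
  obtain c d where c: "c > 0" "\<And>x. c * norm x \<le> norm (K x)"
    and d: "d > 0" "\<And>x. d * norm x \<le> norm (L x)"
    using assms unfolding bounded_below_def by blast
  have "(c * d) * norm x \<le> norm (K (L x))" for x
  proof -
    have "c * (d * norm x) \<le> c * norm (L x)" using c(1) d(2) by (intro mult_left_mono) auto
    also have "\<dots> \<le> norm (K (L x))" by (rule c(2))
    finally show ?thesis by (simp add: mult.assoc)
  qed
  then show ?thesis
    unfolding bounded_below_def using c(1) d(1) by (intro exI[of _ "c * d"]) auto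
qed

lemma inner_imaginary_symmetric:
  fixes A :: "'a::complex_inner \<Rightarrow> 'a"
  assumes "bounded_clinear A" and "\<And>x y. inner (A x) y = inner x (A y)"
  shows "inner (A x) (\<i> *\<^sub>C x) = 0"
proof -
  have "inner (A x) (\<i> *\<^sub>C x) = inner x (\<i> *\<^sub>C A x)"
    by (simp add: assms(2) bounded_clinear_scaleC[OF assms(1)])
  also have "\<dots> = - inner (A x) (\<i> *\<^sub>C x)"
    using inner_scaleC_left[of "- \<i>" x "A x"] by (simp add: scaleC_minus_left inner_commute)
  finally show ?thesis by simp
qed

lemma scaleC_eq_Re_Im: "z *\<^sub>C x = Re z *\<^sub>R x + Im z *\<^sub>R (\<i> *\<^sub>C x)"
  by (simp add: scaleR_scaleC scaleC_scaleC scaleC_add_left[symmetric] mult.commute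
      complex_eq[symmetric])

text \<open>
  Pairing \<open>A x - z x\<close> with \<open>\<i> x\<close> isolates the imaginary part of \<open>z\<close>, and pairing it with \<open>x\<close>
  isolates a negative real part.
\<close>

lemma positive_op_shift_bounded_below:
  assumes A: "positive_op A" and z: "z \<notin> complex_of_real ` {0..onorm A}"
  shows "bounded_below (\<lambda>x. A x - z *\<^sub>C x)"
proof -
  note lin = positive_op_bounded_clinear[OF A]
  consider "Im z \<noteq> 0" | "Im z = 0" "Re z < 0" | "Im z = 0" "Re z > onorm A"
  proof -
    have "Im z = 0 \<Longrightarrow> \<not> (0 \<le> Re z \<and> Re z \<le> onorm A)"
      using z by (metis atLeastAtMost_iff complex_is_Real_iff image_eqI of_real_Re)
    then show ?thesis using that by force
  qed
  then show ?thesis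
  proof cases
    case 1
    show ?thesis
    proof (rule bounded_belowI[of "\<bar>Im z\<bar>"])
      fix x
      have "inner (A x - z *\<^sub>C x) (\<i> *\<^sub>C x) = - Im z * (norm x * norm x)"
        using inner_imaginary_symmetric[OF lin positive_op_symmetric[OF A], of x]
          inner_imaginary_symmetric[OF bounded_clinear_id, of x]
        by (simp add: scaleC_eq_Re_Im[of z] inner_diff_left inner_add_left
            power2_norm_eq_inner[symmetric] norm_scaleC power2_eq_square)
      moreover have "\<bar>inner (A x - z *\<^sub>C x) (\<i> *\<^sub>C x)\<bar> \<le> norm (A x - z *\<^sub>C x) * norm x"
        using Cauchy_Schwarz_ineq2[of "A x - z *\<^sub>C x" "\<i> *\<^sub>C x"] by (simp add: norm_scaleC)
      ultimately show "\<bar>Im z\<bar> * norm x * norm x \<le> norm (A x - z *\<^sub>C x) * norm x"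
        by (simp add: abs_mult mult.assoc)
    qed (use 1 in auto)
  next
    case 2
    show ?thesis
    proof (rule bounded_belowI[of "- Re z"])
      fix x
      have "- Re z * (norm x * norm x) \<le> inner (A x - z *\<^sub>C x) x"
        using positive_op_nonneg[OF A, of x] 2 by (simp add: scaleC_eq_Re_Im[of z] inner_diff_left
            power2_norm_eq_inner[symmetric] power2_eq_square[symmetric])
      also have "\<dots> \<le> norm (A x - z *\<^sub>C x) * norm x" by (rule norm_cauchy_schwarz)
      finally show "- Re z * norm x * norm x \<le> norm (A x - z *\<^sub>C x) * norm x"
        by (simp add: mult.assoc)
    qed (use 2 in auto)
  next
    case 3
    have "(Re z - onorm A) * norm x \<le> norm (A x - z *\<^sub>C x)" for x
    proof -
      have "cmod z = Re z"
        using 3 bounded_clinear_onorm_nonneg[OF lin] by (simp add: cmod_eq_Re)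
      then have "Re z * norm x \<le> norm (A x) + norm (A x - z *\<^sub>C x)"
        using norm_triangle_ineq4[of "A x" "A x - z *\<^sub>C x"] by (simp add: norm_scaleC)
      then show ?thesis using bounded_clinear_norm_le[OF lin, of x] by (simp add: left_diff_distrib)
    qed
    then show ?thesis unfolding bounded_below_def using 3 by (intro exI[of _ "Re z - onorm A"]) auto
  qed
qed

text \<open>
  Outside \<open>[0, onorm A]\<close> both \<open>A - z\<close> and its adjoint \<open>A - cnj z\<close> are bounded below. The first makes
  \<open>A - z\<close> injective with bounded inverse, the second makes it onto.
\<close>

lemma positive_op_spectrum_subset:
  assumes A: "positive_op A"
  shows "op_spectrum A \<subseteq> complex_of_real ` {0..onorm A}"
proof (rule subsetI, rule ccontr)
  fix z assume "z \<in> op_spectrum A" and z: "z \<notin> complex_of_real ` {0..onorm A}"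
  note lin = positive_op_bounded_clinear[OF A]
  define L where "L = (\<lambda>x. A x - z *\<^sub>C x)"
  define L' where "L' = (\<lambda>x. A x - cnj z *\<^sub>C x)"
  have "cnj z \<notin> complex_of_real ` {0..onorm A}"
    using z by (metis complex_cnj_cnj complex_cnj_complex_of_real image_iff)
  then obtain d where d: "d > 0" "\<And>x. d * norm x \<le> norm (L' x)"
    using positive_op_shift_bounded_below[OF A] unfolding bounded_below_def L'_def by blast
  obtain c where c: "c > 0" "\<And>x. c * norm x \<le> norm (L x)"
    using positive_op_shift_bounded_below[OF A z] unfolding bounded_below_def L_def by blast
  have linL: "bounded_clinear L" and linL': "bounded_clinear L'"
    unfolding L_def L'_def by (intro bounded_clinear_sub lin bounded_clinear_scale)+
  have adj: "inner (L' x) y = inner x (L y)" for x y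
    by (simp add: L_def L'_def inner_diff_left inner_diff_right inner_scaleC_left
        positive_op_symmetric[OF A])
  have inj: "x = y" if "L x = L y" for x y
  proof -
    have "c * norm (x - y) \<le> 0" using c(2)[of "x - y"] that by (simp add: bounded_clinear_diff[OF linL])
    then show ?thesis using c(1) by (simp add: mult_le_0_iff)
  qed
  have "\<exists>y. L y = w" for w
  proof -
    obtain y where "\<And>x. inner (L' x) (L' y) = inner x w"
      using variational_solution[OF bounded_clinear_bounded_linear[OF linL']
          bounded_linear_inner_left d] by blast
    then have "L (L' y) = w" by (intro inner_eq_imp_eq[where u = "L (L' y)"]) (simp add: adj)
    then show ?thesis ..
  qed
  then obtain R where R: "\<And>w. L (R w) = w" by metis
  have "bounded_clinear R"
  proof (rule bounded_clinearI)
    show "R (x + y) = R x + R y" for x y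
      by (rule inj) (simp add: R bounded_clinear_add[OF linL])
    show "R (a *\<^sub>C x) = a *\<^sub>C R x" for a x
      by (rule inj) (simp add: R bounded_clinear_scaleC[OF linL])
    show "norm (R x) \<le> (1 / c) * norm x" for x
      using c(1) c(2)[of "R x"] by (simp add: R field_simps)
  qed
  moreover have "R (A x - z *\<^sub>C x) = x" for x
    by (rule inj) (simp add: R, simp add: L_def)
  moreover have "A (R x) - z *\<^sub>C R x = x" for x
    using R[of x] by (simp add: L_def)
  ultimately show False using \<open>z \<in> op_spectrum A\<close> unfolding op_spectrum_def by blast
qed

lemma positive_op_spectrumD:
  assumes "positive_op A" "z \<in> op_spectrum A"
  shows "0 \<le> Re z" "Re z \<le> onorm A" "complex_of_real (Re z) = z" "cnj z = z"
  using positive_op_spectrum_subset[OF assms(1)] assms(2) by auto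

lemma not_in_spectrum_bounded_below:
  assumes "z \<notin> op_spectrum A"
  shows "bounded_below (\<lambda>x. A x - z *\<^sub>C x)"
proof -
  obtain R where R: "bounded_clinear R" "\<And>x. R (A x - z *\<^sub>C x) = x"
    using assms unfolding op_spectrum_def by blast
  have "1 / (onorm R + 1) * norm x \<le> norm (A x - z *\<^sub>C x)" for x
  proof -
    have "norm x \<le> onorm R * norm (A x - z *\<^sub>C x)"
      using bounded_clinear_norm_le[OF R(1), of "A x - z *\<^sub>C x"] by (simp add: R(2))
    also have "\<dots> \<le> (onorm R + 1) * norm (A x - z *\<^sub>C x)" by (intro mult_right_mono) auto
    finally show ?thesis
      using bounded_clinear_onorm_nonneg[OF R(1)] by (simp add: field_simps)
  qed
  then show ?thesis
    unfolding bounded_below_def using bounded_clinear_onorm_nonneg[OF R(1)]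
    by (intro exI[of _ "1 / (onorm R + 1)"]) auto
qed

section \<open>Polynomials in an operator\<close>

lemma op_poly_eq_sum:
  assumes "degree P \<le> n"
  shows "op_poly P A x = (\<Sum>i\<le>n. coeff P i *\<^sub>C (A ^^ i) x)"
  unfolding op_poly_def
  using assms by (intro sum.mono_neutral_left) (auto simp: coeff_eq_0)

lemma op_poly_0 [simp]: "op_poly 0 A x = 0"
  by (simp add: op_poly_def)

lemma op_poly_pCons:
  assumes "bounded_clinear A"
  shows "op_poly (pCons a P) A x = a *\<^sub>C x + A (op_poly P A x)"
proof -
  have "op_poly (pCons a P) A x = (\<Sum>i\<le>Suc (degree P). coeff (pCons a P) i *\<^sub>C (A ^^ i) x)"
    by (rule op_poly_eq_sum) (simp add: degree_pCons_le)
  also have "\<dots> = a *\<^sub>C x + (\<Sum>i\<le>degree P. coeff P i *\<^sub>C A ((A ^^ i) x))"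
    by (subst sum.atMost_Suc_shift) simp
  also have "(\<Sum>i\<le>degree P. coeff P i *\<^sub>C A ((A ^^ i) x)) = A (op_poly P A x)"
    by (simp add: op_poly_def bounded_clinear_scaleC[OF assms]
        linear_sum[OF bounded_linear.linear[OF bounded_clinear_bounded_linear[OF assms]]])
  finally show ?thesis .
qed

lemma op_poly_add: "op_poly (P + Q) A x = op_poly P A x + op_poly Q A x"
proof -
  let ?n = "max (degree P) (degree Q)"
  have "degree (P + Q) \<le> ?n" by (simp add: degree_add_le)
  then show ?thesis
    by (simp add: op_poly_eq_sum[of _ ?n] sum.distrib scaleC_add_left)
qed

lemma op_poly_smult: "op_poly (smult c P) A x = c *\<^sub>C op_poly P A x"
proof -
  have sum: "c *\<^sub>C (\<Sum>i\<le>n. f i) = (\<Sum>i\<le>n. c *\<^sub>C f i)" for f :: "nat \<Rightarrow> 'a" and n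
    by (induction n) (auto simp: scaleC_add_right)
  have "op_poly (smult c P) A x = (\<Sum>i\<le>degree P. coeff (smult c P) i *\<^sub>C (A ^^ i) x)"
    by (rule op_poly_eq_sum) (rule degree_smult_le)
  then show ?thesis by (simp add: op_poly_def sum scaleC_scaleC)
qed

lemma op_poly_diff: "op_poly (P - Q) A x = op_poly P A x - op_poly Q A x"
  using op_poly_add[of P "- Q" A x] op_poly_smult[of "- 1" Q A x]
  by (simp add: scaleC_minus_left)

lemma op_poly_mult:
  assumes A: "bounded_clinear A"
  shows "op_poly (P * Q) A x = op_poly P A (op_poly Q A x)"
  by (induction P) (simp_all add: op_poly_pCons[OF A] op_poly_add op_poly_smult mult_pCons_left)

lemma op_poly_const: "bounded_clinear A \<Longrightarrow> op_poly [:a:] A x = a *\<^sub>C x"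
  by (simp add: op_poly_pCons bounded_clinear_zero)

lemma op_poly_X: "bounded_clinear A \<Longrightarrow> op_poly [:0, 1:] A x = A x"
  by (simp add: op_poly_pCons bounded_clinear_zero)

lemma op_poly_commute:
  assumes A: "bounded_clinear A"
  shows "op_poly P A (op_poly Q A x) = op_poly Q A (op_poly P A x)"
  by (metis op_poly_mult[OF A] mult.commute)

lemma bounded_clinear_op_poly:
  assumes A: "bounded_clinear A"
  shows "bounded_clinear (op_poly P A)"
proof (induction P)
  case 0
  have "bounded_clinear (\<lambda>x::'a. 0)" by (rule bounded_clinearI[where K = 0]) auto
  then show ?case by simp
next
  case (pCons a P)
  have "bounded_clinear (\<lambda>x. a *\<^sub>C x + A (op_poly P A x))"
    by (intro bounded_clinear_plus bounded_clinear_scale bounded_clinear_compose[OF A] pCons)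
  moreover have "op_poly (pCons a P) A = (\<lambda>x. a *\<^sub>C x + A (op_poly P A x))"
    by (rule ext) (rule op_poly_pCons[OF A])
  ultimately show ?case by simp
qed

lemma inner_op_poly:
  assumes A: "positive_op A"
  shows "inner (op_poly P A x) y = inner x (op_poly (map_poly cnj P) A y)"
proof (induction P arbitrary: y)
  case 0
  then show ?case by simp
next
  case (pCons a P)
  note lin = positive_op_bounded_clinear[OF A]
  have comm: "op_poly (map_poly cnj P) A (A y) = A (op_poly (map_poly cnj P) A y)"
    using op_poly_commute[OF lin, of _ "[:0, 1:]" y] by (simp add: op_poly_X[OF lin])
  have "inner (op_poly (pCons a P) A x) y
      = inner x (cnj a *\<^sub>C y) + inner (op_poly P A x) (A y)"
    by (simp add: op_poly_pCons[OF lin] inner_add_left inner_scaleC_left positive_op_symmetric[OF A])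
  also have "\<dots> = inner x (op_poly (map_poly cnj (pCons a P)) A y)"
    by (simp add: pCons map_poly_pCons op_poly_pCons[OF lin] inner_add_right comm)
  finally show ?case .
qed

text \<open>Up to a nonzero constant, \<open>Q(A)\<close> is a product of operators \<open>A - z\<close>, \<open>z\<close> a root of \<open>Q\<close>.\<close>

lemma op_poly_bounded_below:
  assumes A: "bounded_clinear A" and "Q \<noteq> 0"
    and "\<And>z. poly Q z = 0 \<Longrightarrow> z \<notin> op_spectrum A"
  shows "bounded_below (op_poly Q A)"
  using assms(2,3)
proof (induction "degree Q" arbitrary: Q)
  case 0
  then obtain a where Q: "Q = [:a:]" "a \<noteq> 0" by (metis degree_0_id pCons_0_0)
  then show ?case
    unfolding bounded_below_def
    by (intro exI[of _ "cmod a"]) (auto simp: op_poly_const[OF A] norm_scaleC)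
next
  case (Suc n)
  then have "\<not> constant (poly Q)" by (simp add: constant_degree)
  then obtain z where z: "poly Q z = 0" using fundamental_theorem_of_algebra by blast
  then obtain Q' where Q': "Q = [:- z, 1:] * Q'" by (auto simp: poly_eq_0_iff_dvd)
  with Suc.prems(1) have "Q' \<noteq> 0" by auto
  then have "degree Q = Suc (degree Q')" by (simp add: Q' degree_mult_eq del: mult_pCons_left)
  with Suc.hyps(2) have "n = degree Q'" by simp
  then have "bounded_below (op_poly Q' A)"
    using Suc.hyps(1)[of Q'] \<open>Q' \<noteq> 0\<close> Suc.prems(2) Q' by auto
  moreover have "bounded_below (\<lambda>x. A x - z *\<^sub>C x)"
    using not_in_spectrum_bounded_below Suc.prems(2) z by blast
  moreover have "op_poly Q A = (\<lambda>x. A (op_poly Q' A x) - z *\<^sub>C op_poly Q' A x)"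
    by (rule ext, unfold Q' op_poly_mult[OF A])
       (simp add: op_poly_pCons[OF A] bounded_clinear_zero[OF A] scaleC_minus_left)
  ultimately show ?case using bounded_below_compose by fastforce
qed

text \<open>
  Let \<open>B = P(A)\<close> and \<open>m = onorm B\<close>. For unit vectors \<open>x\<close> with \<open>norm (B x)\<close> close to \<open>m\<close>, expanding
  the square shows that \<open>B\<^sup>* B x - m\<^sup>2 x\<close> is small.
\<close>

lemma op_poly_norm_not_bounded_below:
  fixes A :: "'a::chilbert_space \<Rightarrow> 'a"
  assumes A: "positive_op A" and "(x0::'a) \<noteq> 0" and m: "m = onorm (op_poly P A)"
  shows "\<not> bounded_below (op_poly (map_poly cnj P * P - [:complex_of_real (m\<^sup>2):]) A)"
proof
  note lin = positive_op_bounded_clinear[OF A]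
  define B where "B = op_poly P A"
  define B' where "B' = op_poly (map_poly cnj P) A"
  note linB = bounded_clinear_op_poly[OF lin, of P, folded B_def]
  have m0: "0 \<le> m" using bounded_clinear_onorm_nonneg[OF linB] by (simp add: m B_def)
  have Bm: "norm (B x) \<le> m * norm x" for x
    using bounded_clinear_norm_le[OF linB] by (simp add: m B_def)
  have adj: "inner (B x) y = inner x (B' y)" for x y
    unfolding B_def B'_def by (rule inner_op_poly[OF A])
  have B'm: "norm (B' y) \<le> m * norm y" for y
  proof (cases "B' y = 0")
    case False
    have "norm (B' y) * norm (B' y) = inner (B (B' y)) y"
      by (simp add: adj power2_eq_square[symmetric] power2_norm_eq_inner)
    also have "\<dots> \<le> norm (B (B' y)) * norm y" by (rule norm_cauchy_schwarz)
    also have "\<dots> \<le> (m * norm (B' y)) * norm y" by (intro mult_right_mono Bm) auto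
    finally show ?thesis using False by (simp add: mult_ac)
  qed (use m0 in auto)
  assume "bounded_below (op_poly (map_poly cnj P * P - [:complex_of_real (m\<^sup>2):]) A)"
  moreover have "op_poly (map_poly cnj P * P - [:complex_of_real (m\<^sup>2):]) A x = B' (B x) - m\<^sup>2 *\<^sub>R x" for x
    by (simp only: op_poly_diff op_poly_mult[OF lin] op_poly_const[OF lin] B_def B'_def scaleR_scaleC)
  ultimately obtain d where d: "d > 0" "\<And>x. d * norm x \<le> norm (B' (B x) - m\<^sup>2 *\<^sub>R x)"
    unfolding bounded_below_def by auto
  have key: "d\<^sup>2 * (norm x)\<^sup>2 \<le> m\<^sup>2 * (m\<^sup>2 * (norm x)\<^sup>2 - (norm (B x))\<^sup>2)" for x
  proof -
    have "d\<^sup>2 * (norm x)\<^sup>2 \<le> (norm (B' (B x) - m\<^sup>2 *\<^sub>R x))\<^sup>2"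
      using power_mono[OF d(2)[of x], of 2] d(1) by (simp add: power_mult_distrib)
    also have "\<dots> = (norm (B' (B x)))\<^sup>2 - 2 * m\<^sup>2 * inner x (B' (B x)) + m\<^sup>2 * m\<^sup>2 * (norm x)\<^sup>2"
      by (simp add: power2_norm_eq_inner inner_diff_left inner_diff_right inner_commute algebra_simps)
    also have "inner x (B' (B x)) = (norm (B x))\<^sup>2"
      by (simp add: adj[symmetric] power2_norm_eq_inner)
    also have "(norm (B' (B x)))\<^sup>2 \<le> m\<^sup>2 * (norm (B x))\<^sup>2"
      using power_mono[OF B'm[of "B x"], of 2] by (simp add: power_mult_distrib)
    finally show ?thesis by (simp add: algebra_simps)
  qed
  have "m \<noteq> 0"
  proof
    assume "m = 0"
    then have "d\<^sup>2 * (norm x0)\<^sup>2 \<le> 0" using key[of x0] by simp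
    then show False using d(1) assms(2) by (simp add: mult_le_0_iff)
  qed
  then have m1: "m\<^sup>2 > 0" by simp
  define k where "k = m\<^sup>2 - d\<^sup>2 / m\<^sup>2"
  have k: "(norm (B x))\<^sup>2 \<le> k * (norm x)\<^sup>2" for x
    using key[of x] m1 unfolding k_def by (simp add: field_simps)
  have "0 \<le> k * (norm x0)\<^sup>2" using k[of x0] by (meson order_trans zero_le_power2)
  then have k0: "0 \<le> k" using assms(2) by (simp add: zero_le_mult_iff)
  have "norm (B x) \<le> sqrt k * norm x" for x
    using real_sqrt_le_mono[OF k[of x]] by (simp add: real_sqrt_mult)
  then have "onorm B \<le> sqrt k" using k0 by (intro onorm_bound) auto
  then have "m \<le> sqrt k" by (simp add: m B_def)
  then have "m\<^sup>2 \<le> k" using k0 m0 by (metis power_mono real_sqrt_pow2)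
  then show False using d(1) m1 by (simp add: k_def divide_le_0_iff)
qed

lemma ex_spectrum_norm_op_poly:
  fixes A :: "'a::chilbert_space \<Rightarrow> 'a"
  assumes A: "positive_op A" and x0: "(x0::'a) \<noteq> 0"
  shows "\<exists>z\<in>op_spectrum A. cmod (poly P z) = onorm (op_poly P A)"
proof -
  note lin = positive_op_bounded_clinear[OF A]
  define Q where "Q = (\<lambda>P. map_poly cnj P * P - [:complex_of_real ((onorm (op_poly P A))\<^sup>2):])"
  have root: "\<exists>z\<in>op_spectrum A. poly (Q P) z = 0" if "Q P \<noteq> 0" for P
    using op_poly_bounded_below[OF lin that]
      op_poly_norm_not_bounded_below[OF A x0 refl, of P] unfolding Q_def by blast
  (* If Q P vanishes identically, any spectral value will do; one exists by the case P = X. *)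
  have "\<exists>z\<in>op_spectrum A. poly (Q P) z = 0"
  proof (cases "Q P = 0")
    case True
    have "coeff (Q [:0, 1:]) 2 = 1"
      by (simp add: Q_def map_poly_pCons numeral_2_eq_2)
    then have "Q [:0, 1:] \<noteq> 0" by auto
    from root[OF this] True show ?thesis by auto
  qed (rule root)
  then obtain z where z: "z \<in> op_spectrum A" "poly (Q P) z = 0" by blast
  then have "complex_of_real ((cmod (poly P z))\<^sup>2) = complex_of_real ((onorm (op_poly P A))\<^sup>2)"
    using positive_op_spectrumD(4)[OF A z(1)]
    by (simp add: Q_def complex_norm_square[symmetric] mult.commute[of "cnj _"])
  then have "(cmod (poly P z))\<^sup>2 = (onorm (op_poly P A))\<^sup>2"
    by (simp only: of_real_eq_iff)
  then have "cmod (poly P z) = onorm (op_poly P A)"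
    using bounded_clinear_onorm_nonneg[OF bounded_clinear_op_poly[OF lin]]
    by (simp add: power2_eq_iff_nonneg)
  then show ?thesis using z(1) by blast
qed

lemma norm_op_poly_le:
  assumes A: "positive_op A" and c: "\<And>z. z \<in> op_spectrum A \<Longrightarrow> cmod (poly P z) \<le> c"
  shows "norm (op_poly P A x) \<le> c * norm x"
proof (cases "x = 0")
  case True
  then show ?thesis
    using bounded_clinear_zero[OF bounded_clinear_op_poly[OF positive_op_bounded_clinear[OF A]]]
    by simp
next
  case False
  obtain z where "z \<in> op_spectrum A" "cmod (poly P z) = onorm (op_poly P A)"
    using ex_spectrum_norm_op_poly[OF A False] by blast
  then have *: "onorm (op_poly P A) \<le> c" using c[of z] by simp
  have "norm (op_poly P A x) \<le> onorm (op_poly P A) * norm x"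
    by (intro bounded_clinear_norm_le bounded_clinear_op_poly positive_op_bounded_clinear A)
  also have "\<dots> \<le> c * norm x" by (intro mult_right_mono *) simp
  finally show ?thesis .
qed

section \<open>Continuous functional calculus of a positive operator\<close>

text \<open>
  The relation of which \<open>op_cfc f A\<close> is the definite description: its existence, uniqueness and norm
  estimates are proved separately before the description is resolved in \<open>op_cfc_eq\<close>.
\<close>

definition cfc_limit ::
    "('a::chilbert_space \<Rightarrow> 'a) \<Rightarrow> (complex \<Rightarrow> complex) \<Rightarrow> ('a \<Rightarrow> 'a) \<Rightarrow> bool" where
  "cfc_limit A f B \<longleftrightarrow> bounded_clinear B \<and>
     (\<exists>P :: nat \<Rightarrow> complex poly.
        uniform_limit (op_spectrum A) (\<lambda>n z. poly (P n) z) f sequentially \<and>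
        (\<lambda>n. onorm (\<lambda>x. op_poly (P n) A x - B x)) \<longlonglongrightarrow> 0)"

lemma ex_small_multiple:
  fixes e k :: real
  assumes "e > 0" "k \<ge> 0"
  shows "\<exists>d>0. d * k < e"
proof (intro exI conjI)
  have "k + 1 > 0" using assms(2) by simp
  then show "e / (k + 1) > 0" "e / (k + 1) * k < e"
    using assms by (simp_all add: pos_divide_less_eq)
qed

lemma cfc_limit_op_poly:
  assumes "bounded_clinear A"
  shows "cfc_limit A (poly P) (op_poly P A)"
  unfolding cfc_limit_def
proof (intro conjI exI[of _ "\<lambda>_. P"])
  show "uniform_limit (op_spectrum A) (\<lambda>n. poly P) (poly P) sequentially"
    by (auto intro!: uniform_limitI)
qed (simp_all add: bounded_clinear_op_poly[OF assms] onorm_zero)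

lemma cfc_limit_approx:
  assumes A: "positive_op A" and B: "cfc_limit A f B" and e: "e > 0"
  obtains P where "\<And>z. z \<in> op_spectrum A \<Longrightarrow> cmod (poly P z - f z) < e"
    and "\<And>x. norm (op_poly P A x - B x) \<le> e * norm x"
proof -
  obtain P where P: "uniform_limit (op_spectrum A) (\<lambda>n z. poly (P n) z) f sequentially"
    "(\<lambda>n. onorm (\<lambda>x. op_poly (P n) A x - B x)) \<longlonglongrightarrow> 0" and linB: "bounded_clinear B"
    using B unfolding cfc_limit_def by blast
  have "\<forall>\<^sub>F n in sequentially. \<forall>z\<in>op_spectrum A. dist (poly (P n) z) (f z) < e"
    using P(1) e by (rule uniform_limitD)
  moreover have "\<forall>\<^sub>F n in sequentially. onorm (\<lambda>x. op_poly (P n) A x - B x) < e"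
    using order_tendstoD(2)[OF P(2) e] .
  ultimately have "\<forall>\<^sub>F n in sequentially. (\<forall>z\<in>op_spectrum A. dist (poly (P n) z) (f z) < e) \<and>
      onorm (\<lambda>x. op_poly (P n) A x - B x) < e"
    by (rule eventually_conj)
  then obtain n where n: "\<forall>z\<in>op_spectrum A. dist (poly (P n) z) (f z) < e"
      "onorm (\<lambda>x. op_poly (P n) A x - B x) < e"
    using eventually_happens'[OF sequentially_bot] by blast
  show thesis
  proof
    show "cmod (poly (P n) z - f z) < e" if "z \<in> op_spectrum A" for z
      using n(1) that by (simp add: dist_norm)
    fix x
    have "norm (op_poly (P n) A x - B x) \<le> onorm (\<lambda>x. op_poly (P n) A x - B x) * norm x"
      by (rule bounded_clinear_norm_le)
         (intro bounded_clinear_sub bounded_clinear_op_poly positive_op_bounded_clinear A linB)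
    also have "\<dots> \<le> e * norm x" using n(2) by (intro mult_right_mono) auto
    finally show "norm (op_poly (P n) A x - B x) \<le> e * norm x" .
  qed
qed

lemma le_if_le_add_small_multiple:
  fixes a b k :: real
  assumes "k \<ge> 0" and "\<And>e. e > 0 \<Longrightarrow> a \<le> b + e * k"
  shows "a \<le> b"
proof (rule field_le_epsilon)
  fix d :: real assume "d > 0"
  then have "a \<le> b + d / (k + 1) * k" using assms(1) by (intro assms(2)) auto
  also have "d / (k + 1) * k \<le> d" using assms(1) \<open>d > 0\<close> by (simp add: field_simps)
  finally show "a \<le> b + d" by simp
qed

lemma poly_bounded_on_spectrum:
  assumes "positive_op A"
  obtains K where "K \<ge> 0" "\<And>z. z \<in> op_spectrum A \<Longrightarrow> cmod (poly Q z) \<le> K"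
proof -
  have "compact (poly Q ` complex_of_real ` {0..onorm A})"
    by (intro compact_continuous_image continuous_intros compact_Icc)
  then have "bounded (poly Q ` complex_of_real ` {0..onorm A})" by (rule compact_imp_bounded)
  then obtain K where K: "\<And>z. z \<in> complex_of_real ` {0..onorm A} \<Longrightarrow> cmod (poly Q z) \<le> K"
    unfolding bounded_iff by blast
  show thesis
    by (rule that[of "max K 0"])
       (use K positive_op_spectrum_subset[OF assms] in \<open>auto simp: le_max_iff_disj\<close>)
qed

text \<open>
  The norm estimate for polynomials passes to limits. Taking \<open>c = 0\<close> and \<open>Q = 1\<close> it gives
  uniqueness of the functional calculus; with a general \<open>Q\<close> it compares different powers.
\<close>

lemma cfc_limit_norm_diff_le:
  assumes A: "positive_op A" and B: "cfc_limit A f B" and C: "cfc_limit A g C"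
    and c: "\<And>z. z \<in> op_spectrum A \<Longrightarrow> cmod (f z - poly Q z * g z) \<le> c"
  shows "norm (B x - op_poly Q A (C x)) \<le> c * norm x"
proof -
  note lin = positive_op_bounded_clinear[OF A]
  note linQ = bounded_clinear_op_poly[OF lin, of Q]
  obtain K where K: "K \<ge> 0" "\<And>z. z \<in> op_spectrum A \<Longrightarrow> cmod (poly Q z) \<le> K"
    using poly_bounded_on_spectrum[OF A, of Q] by blast
  define N where "N = onorm (op_poly Q A)"
  have N: "N \<ge> 0" unfolding N_def by (rule bounded_clinear_onorm_nonneg[OF linQ])
  show ?thesis
  proof (rule le_if_le_add_small_multiple)
    show "0 \<le> (2 + K + N) * norm x" using K(1) N by simp
    fix e :: real assume e: "e > 0"
    obtain P where P: "\<And>z. z \<in> op_spectrum A \<Longrightarrow> cmod (poly P z - f z) < e"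
      "\<And>x. norm (op_poly P A x - B x) \<le> e * norm x"
      using cfc_limit_approx[OF A B e] by blast
    obtain R where R: "\<And>z. z \<in> op_spectrum A \<Longrightarrow> cmod (poly R z - g z) < e"
      "\<And>x. norm (op_poly R A x - C x) \<le> e * norm x"
      using cfc_limit_approx[OF A C e] by blast
    have "cmod (poly (P - Q * R) z) \<le> e + c + K * e" if z: "z \<in> op_spectrum A" for z
    proof -
      have "poly (P - Q * R) z = (poly P z - f z) + (f z - poly Q z * g z)
          - poly Q z * (poly R z - g z)" by (simp add: algebra_simps)
      also have "cmod \<dots> \<le> cmod (poly P z - f z) + cmod (f z - poly Q z * g z)
          + cmod (poly Q z) * cmod (poly R z - g z)"
        by (metis (no_types, opaque_lifting) norm_mult norm_triangle_ineq norm_triangle_ineq4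
            add_right_mono order_trans)
      also have "\<dots> \<le> e + c + K * e"
        using P(1)[OF z] c[OF z] R(1)[OF z] K(2)[OF z] K(1)
        by (intro add_mono mult_mono) auto
      finally show ?thesis .
    qed
    then have 1: "norm (op_poly (P - Q * R) A x) \<le> (e + c + K * e) * norm x"
      by (rule norm_op_poly_le[OF A])
    have "norm (op_poly Q A (op_poly R A x - C x)) \<le> N * norm (op_poly R A x - C x)"
      unfolding N_def by (rule bounded_clinear_norm_le[OF linQ])
    also have "\<dots> \<le> N * (e * norm x)" using N by (intro mult_left_mono R(2))
    finally have 2: "norm (op_poly Q A (op_poly R A x - C x)) \<le> N * (e * norm x)" .
    have "B x - op_poly Q A (C x) = op_poly (P - Q * R) A x - (op_poly P A x - B x)
        + op_poly Q A (op_poly R A x - C x)"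
      by (simp add: op_poly_diff op_poly_mult[OF lin] bounded_clinear_diff[OF linQ])
    also have "norm \<dots> \<le> norm (op_poly (P - Q * R) A x) + norm (op_poly P A x - B x)
        + norm (op_poly Q A (op_poly R A x - C x))"
      by (metis (no_types, opaque_lifting) norm_triangle_ineq norm_triangle_ineq4
          add_right_mono order_trans)
    also have "\<dots> \<le> (e + c + K * e) * norm x + e * norm x + N * (e * norm x)"
      by (intro add_mono 1 2 P(2))
    finally show "norm (B x - op_poly Q A (C x)) \<le> c * norm x + e * ((2 + K + N) * norm x)"
      by (simp add: algebra_simps)
  qed
qed

lemma op_poly_1 [simp]: "op_poly 1 A x = x"
  by (simp add: op_poly_def)

lemma cfc_limit_unique:
  assumes A: "positive_op A" and B: "cfc_limit A f B" and C: "cfc_limit A f C"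
  shows "B = C"
  using cfc_limit_norm_diff_le[OF A B C, of 1 0] by (intro ext) simp

lemma op_cfc_eq:
  assumes "positive_op A" "cfc_limit A f B"
  shows "op_cfc f A = B"
proof -
  have "op_cfc f A = (THE B. cfc_limit A f B)" unfolding op_cfc_def cfc_limit_def ..
  also have "\<dots> = B" using cfc_limit_unique[OF assms(1)] assms(2) by blast
  finally show ?thesis .
qed

lemma cfc_limit_tendsto:
  assumes A: "positive_op A" and B: "cfc_limit A f B"
    and P: "uniform_limit (op_spectrum A) (\<lambda>n z. poly (P n) z) f sequentially"
  shows "(\<lambda>n. op_poly (P n) A x) \<longlonglongrightarrow> B x"
proof (rule tendstoI)
  fix e :: real assume e: "e > 0"
  obtain d where d: "d > 0" "d * norm x < e"
    using ex_small_multiple[OF e, of "norm x"] by auto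
  have "\<forall>\<^sub>F n in sequentially. \<forall>z\<in>op_spectrum A. dist (poly (P n) z) (f z) < d"
    using P d(1) by (rule uniform_limitD)
  then show "\<forall>\<^sub>F n in sequentially. dist (op_poly (P n) A x) (B x) < e"
  proof (rule eventually_mono)
    fix n assume n: "\<forall>z\<in>op_spectrum A. dist (poly (P n) z) (f z) < d"
    have "norm (B x - op_poly 1 A (op_poly (P n) A x)) \<le> d * norm x"
      by (rule cfc_limit_norm_diff_le[OF A B cfc_limit_op_poly])
         (use n in \<open>auto simp: dist_norm norm_minus_commute less_imp_le
            intro: positive_op_bounded_clinear A\<close>)
    then show "dist (op_poly (P n) A x) (B x) < e"
      using d(2) by (simp add: dist_norm norm_minus_commute)
  qed
qed

text \<open>
  By the norm estimate the operators \<open>P n (A)\<close> form a Cauchy sequence uniformly on bounded sets, so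
  their pointwise limit is also a limit in operator norm.
\<close>

lemma cfc_limit_exists:
  fixes A :: "'a::chilbert_space \<Rightarrow> 'a"
  assumes A: "positive_op A"
    and P: "uniform_limit (op_spectrum A) (\<lambda>n z. poly (P n) z) f sequentially"
  shows "\<exists>B. cfc_limit A f B"
proof -
  note lin = positive_op_bounded_clinear[OF A]
  have cau: "\<exists>N. \<forall>m\<ge>N. \<forall>n\<ge>N. \<forall>x. norm (op_poly (P m) A x - op_poly (P n) A x) \<le> e * norm x"
    if e: "e > 0" for e
  proof -
    have "\<forall>\<^sub>F n in sequentially. \<forall>z\<in>op_spectrum A. dist (poly (P n) z) (f z) < e / 2"
      using P e by (intro uniform_limitD) auto
    then obtain N where N: "\<And>n z. n \<ge> N \<Longrightarrow> z \<in> op_spectrum A \<Longrightarrow> dist (poly (P n) z) (f z) < e / 2"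
      unfolding eventually_sequentially by blast
    have "norm (op_poly (P m) A x - op_poly (P n) A x) \<le> e * norm x" if "m \<ge> N" "n \<ge> N" for m n x
    proof -
      have "norm (op_poly (P m - P n) A x) \<le> e * norm x"
      proof (rule norm_op_poly_le[OF A])
        fix z assume "z \<in> op_spectrum A"
        then show "cmod (poly (P m - P n) z) \<le> e"
          using dist_triangle_half_l[OF N[OF that(1)] N[OF that(2)], of z]
          by (simp add: dist_norm less_imp_le)
      qed
      then show ?thesis by (simp add: op_poly_diff)
    qed
    then show ?thesis by blast
  qed
  have "convergent (\<lambda>n. op_poly (P n) A x)" for x
  proof (rule Cauchy_convergent, rule metric_CauchyI)
    fix e :: real assume e: "e > 0"
    obtain d where d: "d > 0" "d * norm x < e"
    using ex_small_multiple[OF e, of "norm x"] by auto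
    show "\<exists>N. \<forall>m\<ge>N. \<forall>n\<ge>N. dist (op_poly (P m) A x) (op_poly (P n) A x) < e"
      using cau[OF d(1)] d(2) unfolding dist_norm by (meson le_less_trans)
  qed
  then obtain B where lim: "\<And>x. (\<lambda>n. op_poly (P n) A x) \<longlonglongrightarrow> B x"
    unfolding convergent_def by metis
  have close: "\<exists>N. \<forall>n\<ge>N. \<forall>x. norm (op_poly (P n) A x - B x) \<le> e * norm x" if "e > 0" for e
  proof -
    obtain N where N: "\<And>m n x. m \<ge> N \<Longrightarrow> n \<ge> N \<Longrightarrow>
        norm (op_poly (P m) A x - op_poly (P n) A x) \<le> e * norm x"
      using cau[OF \<open>e > 0\<close>] by blast
    have "norm (op_poly (P n) A x - B x) \<le> e * norm x" if "n \<ge> N" for n x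
    proof (rule Lim_bounded)
      show "(\<lambda>m. norm (op_poly (P n) A x - op_poly (P m) A x)) \<longlonglongrightarrow> norm (op_poly (P n) A x - B x)"
        by (intro tendsto_intros lim)
      show "\<forall>m\<ge>N. norm (op_poly (P n) A x - op_poly (P m) A x) \<le> e * norm x"
        using N[OF that] by blast
    qed
    then show ?thesis by blast
  qed
  note linP = bounded_clinear_op_poly[OF lin]
  have linB: "bounded_clinear B"
  proof -
    obtain N where N: "\<And>x. norm (op_poly (P N) A x - B x) \<le> norm x"
      using close[of 1] by auto
    show ?thesis
    proof (rule bounded_clinearI)
      show "B (x + y) = B x + B y" for x y
      proof (rule LIMSEQ_unique[OF lim])
        show "(\<lambda>n. op_poly (P n) A (x + y)) \<longlonglongrightarrow> B x + B y"
          unfolding bounded_clinear_add[OF linP] by (intro tendsto_intros lim)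
      qed
      show "B (c *\<^sub>C x) = c *\<^sub>C B x" for c x
      proof (rule LIMSEQ_unique[OF lim])
        show "(\<lambda>n. op_poly (P n) A (c *\<^sub>C x)) \<longlonglongrightarrow> c *\<^sub>C B x"
          unfolding bounded_clinear_scaleC[OF linP]
          by (rule bounded_linear.tendsto[OF bounded_clinear_bounded_linear[OF bounded_clinear_scale] lim])
      qed
      show "norm (B x) \<le> (onorm (op_poly (P N) A) + 1) * norm x" for x
        using N[of x] bounded_clinear_norm_le[OF linP, of "P N" x]
          norm_triangle_ineq4[of "op_poly (P N) A x" "op_poly (P N) A x - B x"]
        by (simp add: algebra_simps)
    qed
  qed
  have "(\<lambda>n. onorm (\<lambda>x. op_poly (P n) A x - B x)) \<longlonglongrightarrow> 0"
  proof (rule LIMSEQ_I)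
    fix e :: real assume e: "e > 0"
    obtain N where N: "\<And>n x. n \<ge> N \<Longrightarrow> norm (op_poly (P n) A x - B x) \<le> e / 2 * norm x"
      using close[of "e / 2"] e by auto
    have "norm (onorm (\<lambda>x. op_poly (P n) A x - B x) - 0) < e" if "n \<ge> N" for n
    proof -
      have "onorm (\<lambda>x. op_poly (P n) A x - B x) \<le> e / 2"
        using e N[OF that] by (intro onorm_bound) auto
      moreover have "0 \<le> onorm (\<lambda>x. op_poly (P n) A x - B x)"
        by (intro bounded_clinear_onorm_nonneg bounded_clinear_sub linP linB)
      ultimately show ?thesis using e by simp
    qed
    then show "\<exists>N. \<forall>n\<ge>N. norm (onorm (\<lambda>x. op_poly (P n) A x - B x) - 0) < e" by blast
  qed
  then show ?thesis using linB P unfolding cfc_limit_def by blast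
qed

lemma Weierstrass_complex_poly:
  fixes g :: "real \<Rightarrow> real"
  assumes "continuous_on {0..M} g" and "e > 0"
  obtains P :: "complex poly"
  where "\<And>x. x \<in> {0..M} \<Longrightarrow> cmod (poly P (complex_of_real x) - complex_of_real (g x)) < e"
proof -
  obtain h where h: "real_polynomial_function h" "\<And>x. x \<in> {0..M} \<Longrightarrow> \<bar>g x - h x\<bar> < e"
    using Stone_Weierstrass_real_polynomial_function[OF compact_Icc assms] by blast
  obtain a n where hn: "h = (\<lambda>x. \<Sum>i\<le>n. a i * x ^ i)"
    using h(1) unfolding real_polynomial_function_iff_sum by blast
  define P where "P = (\<Sum>i\<le>n. monom (complex_of_real (a i)) i)"
  have "poly P (complex_of_real x) = complex_of_real (h x)" for x
    by (simp add: P_def hn poly_sum poly_monom)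
  then have "cmod (poly P (complex_of_real x) - complex_of_real (g x)) = \<bar>g x - h x\<bar>" for x
    by (metis abs_minus_commute norm_of_real of_real_diff)
  then show thesis using that[of P] h(2) by simp
qed

lemma ex_uniform_limit_poly:
  assumes A: "positive_op A" and g: "continuous_on {0..onorm A} g"
  shows "\<exists>P. uniform_limit (op_spectrum A) (\<lambda>n z. poly (P n) z)
           (\<lambda>z. complex_of_real (g (Re z))) sequentially"
proof -
  have "\<exists>P. \<forall>x\<in>{0..onorm A}. cmod (poly P (complex_of_real x) - complex_of_real (g x))
          < 1 / real (Suc n)" for n
    using Weierstrass_complex_poly[OF g, of "1 / real (Suc n)"] by (metis of_nat_0_less_iff zero_less_Suc zero_less_divide_1_iff)
  then obtain P where P: "\<And>n x. x \<in> {0..onorm A} \<Longrightarrow>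
      cmod (poly (P n) (complex_of_real x) - complex_of_real (g x)) < 1 / real (Suc n)"
    by metis
  have "uniform_limit (op_spectrum A) (\<lambda>n z. poly (P n) z)
           (\<lambda>z. complex_of_real (g (Re z))) sequentially"
  proof (rule uniform_limitI)
    fix e :: real assume "e > 0"
    then have "\<forall>\<^sub>F n in sequentially. 1 / real (Suc n) < e"
      by (rule order_tendstoD(2)[OF LIMSEQ_Suc[OF lim_1_over_n]])
    then show "\<forall>\<^sub>F n in sequentially. \<forall>z\<in>op_spectrum A.
        dist (poly (P n) z) (complex_of_real (g (Re z))) < e"
    proof (rule eventually_mono)
      fix n assume n: "1 / real (Suc n) < e"
      show "\<forall>z\<in>op_spectrum A. dist (poly (P n) z) (complex_of_real (g (Re z))) < e"
      proof
        fix z assume z: "z \<in> op_spectrum A"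
        show "dist (poly (P n) z) (complex_of_real (g (Re z))) < e"
          using P[of "Re z" n] positive_op_spectrumD[OF A z] n by (simp add: dist_norm)
      qed
    qed
  qed
  then show ?thesis by blast
qed

section \<open>Powers of a positive operator\<close>

lemma continuous_on_powr_pos: "s > 0 \<Longrightarrow> continuous_on {0..M} (\<lambda>x::real. x powr s)"
  by (intro continuous_on_powr' continuous_intros) auto

lemma cfc_limit_op_powr:
  assumes A: "positive_op A" and s: "s > 0"
  shows "cfc_limit A (\<lambda>z. complex_of_real (Re z powr s)) (op_powr A s)"
proof -
  obtain B where B: "cfc_limit A (\<lambda>z. complex_of_real (Re z powr s)) B"
    using cfc_limit_exists[OF A] ex_uniform_limit_poly[OF A continuous_on_powr_pos[OF s]] by blast
  then show ?thesis by (simp add: op_powr_def op_cfc_eq[OF A B])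
qed

lemma bounded_clinear_op_powr: "positive_op A \<Longrightarrow> s > 0 \<Longrightarrow> bounded_clinear (op_powr A s)"
  using cfc_limit_op_powr unfolding cfc_limit_def by blast

lemma op_powr_1:
  assumes A: "positive_op A"
  shows "op_powr A 1 = A"
proof -
  note lin = positive_op_bounded_clinear[OF A]
  have "norm (op_powr A 1 x - op_poly 1 A (op_poly [:0, 1:] A x)) \<le> 0 * norm x" for x
    by (rule cfc_limit_norm_diff_le[OF A cfc_limit_op_powr[OF A] cfc_limit_op_poly[OF lin]])
       (use positive_op_spectrumD[OF A] in auto)
  then show ?thesis by (intro ext) (simp add: op_poly_X[OF lin])
qed

text \<open>
  If the polynomials \<open>P n\<close> converge to the power \<open>s / 2\<close>, then \<open>A\<^sup>s\<close> is the limit of the operators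
  \<open>P n(A)\<^sup>* P n(A)\<close>.
\<close>

lemma positive_op_powr:
  assumes A: "positive_op A" and s: "s > 0"
  shows "positive_op (op_powr A s)"
proof -
  note lin = positive_op_bounded_clinear[OF A]
  let ?g = "\<lambda>s z. complex_of_real (Re z powr s)"
  obtain P where P: "uniform_limit (op_spectrum A) (\<lambda>n z. poly (P n) z) (?g (s / 2)) sequentially"
    using ex_uniform_limit_poly[OF A continuous_on_powr_pos[of "s / 2"]] s by auto
  have bd: "bounded (?g (s / 2) ` op_spectrum A)"
    unfolding bounded_iff
  proof (intro exI ballI)
    fix w assume "w \<in> ?g (s / 2) ` op_spectrum A"
    then obtain z where z: "z \<in> op_spectrum A" "w = ?g (s / 2) z" by blast
    show "norm w \<le> onorm A powr (s / 2)"
      using positive_op_spectrumD[OF A z(1)] s by (simp add: z(2) powr_mono2)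
  qed
  have P': "uniform_limit (op_spectrum A) (\<lambda>n z. poly (map_poly cnj (P n)) z) (?g (s / 2)) sequentially"
  proof (rule uniform_limitI)
    fix e :: real assume "e > 0"
    from uniform_limitD[OF P this]
    show "\<forall>\<^sub>F n in sequentially. \<forall>z\<in>op_spectrum A. dist (poly (map_poly cnj (P n)) z) (?g (s / 2) z) < e"
    proof (rule eventually_mono, intro ballI)
      fix n z assume n: "\<forall>z\<in>op_spectrum A. dist (poly (P n) z) (?g (s / 2) z) < e"
        and z: "z \<in> op_spectrum A"
      have "poly (map_poly cnj (P n)) z - ?g (s / 2) z = cnj (poly (P n) z - ?g (s / 2) z)"
        by (simp add: positive_op_spectrumD(4)[OF A z])
      then show "dist (poly (map_poly cnj (P n)) z) (?g (s / 2) z) < e"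
        using n z by (metis complex_mod_cnj dist_norm)
    qed
  qed
  have "uniform_limit (op_spectrum A) (\<lambda>n z. poly (map_poly cnj (P n)) z * poly (P n) z)
      (\<lambda>z. ?g (s / 2) z * ?g (s / 2) z) sequentially"
    by (rule uniform_lim_mult[OF P' P bd bd])
  moreover have "?g (s / 2) z * ?g (s / 2) z = ?g s z" for z
    by (simp add: of_real_mult[symmetric] powr_add[symmetric] del: of_real_mult)
  ultimately have "uniform_limit (op_spectrum A) (\<lambda>n z. poly (map_poly cnj (P n) * P n) z)
      (?g s) sequentially" by simp
  from cfc_limit_tendsto[OF A cfc_limit_op_powr[OF A s] this]
  have lim: "(\<lambda>n. op_poly (map_poly cnj (P n) * P n) A x) \<longlonglongrightarrow> op_powr A s x" for x .
  have form: "inner (op_poly (map_poly cnj (P n) * P n) A x) y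
      = inner (op_poly (P n) A x) (op_poly (P n) A y)" for n x y
    using inner_op_poly[OF A, of "P n" y "op_poly (P n) A x"]
    by (simp add: op_poly_mult[OF lin] inner_commute)
  have form': "inner x (op_poly (map_poly cnj (P n) * P n) A y)
      = inner (op_poly (P n) A x) (op_poly (P n) A y)" for n x y
    using form[of n y x] by (simp add: inner_commute)
  have "inner (op_powr A s x) y = inner x (op_powr A s y)" for x y
  proof (rule LIMSEQ_unique)
    show "(\<lambda>n. inner (op_poly (P n) A x) (op_poly (P n) A y)) \<longlonglongrightarrow> inner (op_powr A s x) y"
      unfolding form[symmetric] by (intro tendsto_intros lim)
    show "(\<lambda>n. inner (op_poly (P n) A x) (op_poly (P n) A y)) \<longlonglongrightarrow> inner x (op_powr A s y)"
      unfolding form'[symmetric] by (intro tendsto_intros lim)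
  qed
  moreover have "0 \<le> inner (op_powr A s x) x" for x
  proof (rule LIMSEQ_le_const)
    show "(\<lambda>n. inner (op_poly (map_poly cnj (P n) * P n) A x) x) \<longlonglongrightarrow> inner (op_powr A s x) x"
      by (intro tendsto_intros lim)
  qed (simp add: form)
  ultimately show ?thesis
    unfolding positive_op_def using bounded_clinear_op_powr[OF A s] by blast
qed

lemma op_powr_op_poly_commute:
  assumes A: "positive_op A" and s: "s > 0"
  shows "op_powr A s (op_poly Q A x) = op_poly Q A (op_powr A s x)"
proof -
  note lin = positive_op_bounded_clinear[OF A]
  obtain P where P: "uniform_limit (op_spectrum A) (\<lambda>n z. poly (P n) z)
      (\<lambda>z. complex_of_real (Re z powr s)) sequentially"
    using ex_uniform_limit_poly[OF A continuous_on_powr_pos[OF s]] by blast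
  note lim = cfc_limit_tendsto[OF A cfc_limit_op_powr[OF A s] P]
  show ?thesis
  proof (rule LIMSEQ_unique[OF lim])
    show "(\<lambda>n. op_poly (P n) A (op_poly Q A x)) \<longlonglongrightarrow> op_poly Q A (op_powr A s x)"
      unfolding op_poly_commute[OF lin, of _ Q]
      by (rule bounded_linear.tendsto[OF bounded_clinear_bounded_linear[OF bounded_clinear_op_poly[OF lin]] lim])
  qed
qed

text \<open>
  The quotient \<open>x powr t / x powr s\<close> may blow up at \<open>0\<close>, so its denominator is cut off at a level
  \<open>d\<close> with \<open>d powr t = e\<close>, below which both terms are at most \<open>e\<close>.
\<close>

lemma powr_approx_multiple:
  fixes s t e :: real
  assumes s: "s > 0" and t: "t > 0" and e: "e > 0"
  obtains g where "continuous_on {0..M} g"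
    and "\<And>x. x \<ge> 0 \<Longrightarrow> \<bar>x powr t - g x * x powr s\<bar> \<le> e"
proof -
  define d where "d = e powr (1 / t)"
  have d: "d > 0" "d powr t = e" using e t by (simp_all add: d_def powr_powr)
  define g where "g = (\<lambda>x. x powr t / max x d powr s)"
  show thesis
  proof
    show "continuous_on {0..M} g"
      unfolding g_def using t d(1)
      by (intro continuous_on_divide continuous_on_powr' continuous_intros) auto
    fix x :: real assume x: "x \<ge> 0"
    show "\<bar>x powr t - g x * x powr s\<bar> \<le> e"
    proof (cases "x \<ge> d")
      case True
      then show ?thesis using d(1) e by (simp add: g_def max_def)
    next
      case False
      have "x powr s \<le> d powr s" using False x s by (intro powr_mono2) auto
      then have "x powr s / d powr s \<le> 1" using d(1) by simp
      then have "x powr t * (x powr s / d powr s) \<le> x powr t * 1" by (intro mult_left_mono) auto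
      moreover have "x powr t \<le> e"
        using powr_mono2[of t x d] False x t d(2) by simp
      moreover have "0 \<le> x powr t * (x powr s / d powr s)" by simp
      moreover have "g x * x powr s = x powr t * (x powr s / d powr s)"
        using False by (simp add: g_def max_def)
      ultimately show ?thesis by linarith
    qed
  qed
qed

text \<open>
  Any positive power of \<open>A\<close> is a norm limit of bounded multiples of any other: on the spectrum the
  function \<open>x powr t\<close> is a uniform limit of functions \<open>q x * x powr s\<close> with \<open>q\<close> a polynomial. This is
  what makes compactness insensitive to the exponents.
\<close>

lemma op_powr_approx_multiple:
  assumes A: "positive_op A" and s: "s > 0" and t: "t > 0" and e: "e > 0"
  obtains Q where "\<And>x. norm (op_powr A t x - op_poly Q A (op_powr A s x)) \<le> e * norm x"
proof -
  let ?M = "onorm A"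
  obtain g where g: "continuous_on {0..?M} g"
      "\<And>x. x \<ge> 0 \<Longrightarrow> \<bar>x powr t - g x * x powr s\<bar> \<le> e / 2"
    using powr_approx_multiple[OF s t, of "e / 2"] e by auto
  define d where "d = e / (2 * (?M powr s + 1))"
  have d: "d > 0" "d * ?M powr s \<le> e / 2"
  proof -
    have "?M powr s + 1 > 0" by (simp add: add_nonneg_pos)
    then show "d > 0" "d * ?M powr s \<le> e / 2"
      using e by (simp_all add: d_def field_simps)
  qed
  obtain Q where Q: "\<And>x. x \<in> {0..?M} \<Longrightarrow>
      cmod (poly Q (complex_of_real x) - complex_of_real (g x)) < d"
    using Weierstrass_complex_poly[OF g(1) d(1)] by blast
  have "norm (op_powr A t x - op_poly Q A (op_powr A s x)) \<le> e * norm x" for x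
  proof (rule cfc_limit_norm_diff_le[OF A cfc_limit_op_powr[OF A t] cfc_limit_op_powr[OF A s]])
    fix z assume z: "z \<in> op_spectrum A"
    define u where "u = Re z"
    have u: "0 \<le> u" "u \<le> ?M" "z = complex_of_real u"
      using positive_op_spectrumD[OF A z] by (simp_all add: u_def)
    have "complex_of_real (u powr t) - poly Q z * complex_of_real (u powr s)
        = complex_of_real (u powr t - g u * u powr s)
          - (poly Q z - complex_of_real (g u)) * complex_of_real (u powr s)"
      by (simp add: algebra_simps)
    also have "cmod \<dots> \<le> cmod (complex_of_real (u powr t - g u * u powr s))
          + cmod ((poly Q z - complex_of_real (g u)) * complex_of_real (u powr s))"
      by (rule norm_triangle_ineq4)
    also have "\<dots> \<le> e / 2 + d * ?M powr s"
    proof (rule add_mono)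
      show "cmod (complex_of_real (u powr t - g u * u powr s)) \<le> e / 2"
        using g(2)[OF u(1)] by (simp only: norm_of_real)
      show "cmod ((poly Q z - complex_of_real (g u)) * complex_of_real (u powr s)) \<le> d * ?M powr s"
        unfolding norm_mult norm_of_real using Q[of u] u s d(1)
        by (intro mult_mono) (auto simp: powr_mono2)
    qed
    also have "\<dots> \<le> e" using d(2) by simp
    finally show "cmod (complex_of_real (Re z powr t) - poly Q z * complex_of_real (Re z powr s)) \<le> e"
      by (simp add: u_def)
  qed
  then show thesis by (rule that)
qed

section \<open>Compact operators\<close>

lemma compact_operator_bounded_clinear: "compact_operator K \<Longrightarrow> bounded_clinear K"
  by (simp add: compact_operator_def)

lemma compact_operator_finite_net:
  fixes K :: "'a::chilbert_space \<Rightarrow> 'a"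
  assumes K: "compact_operator K" and e: "e > 0"
  obtains F where "finite F" "F \<subseteq> cball 0 R"
    and "\<And>x. x \<in> cball 0 R \<Longrightarrow> \<exists>y\<in>F. norm (K x - K y) < e"
proof -
  have cpt: "compact (closure (K ` cball 0 R))"
    using K unfolding compact_operator_def by blast
  have cover: "closure (K ` cball 0 R) \<subseteq> (\<Union>y\<in>cball 0 R. ball (K y) e)"
  proof
    fix w assume "w \<in> closure (K ` cball 0 R)"
    then obtain y where "y \<in> cball 0 R" "dist (K y) w < e"
      using e unfolding closure_approachable by blast
    then show "w \<in> (\<Union>y\<in>cball 0 R. ball (K y) e)" by auto
  qed
  obtain F where F: "F \<subseteq> cball 0 R" "finite F"
      "closure (K ` cball 0 R) \<subseteq> (\<Union>y\<in>F. ball (K y) e)"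
    using compactE_image[of _ "cball 0 R" "\<lambda>y. ball (K y) e", OF cpt open_ball cover] by blast
  show thesis
  proof
    fix x :: 'a assume "x \<in> cball 0 R"
    then have "K x \<in> closure (K ` cball 0 R)" by (intro subsetD[OF closure_subset] imageI)
    then have "K x \<in> (\<Union>y\<in>F. ball (K y) e)" by (rule subsetD[OF F(3)])
    then obtain y where "y \<in> F" "K x \<in> ball (K y) e" by blast
    then show "\<exists>y\<in>F. norm (K x - K y) < e"
      by (intro bexI[of _ y]) (simp_all add: dist_norm norm_minus_commute)
  qed (fact F)+
qed

lemma compact_operatorI:
  fixes K :: "'a::chilbert_space \<Rightarrow> 'a"
  assumes K: "bounded_clinear K"
    and net: "\<And>R e. e > 0 \<Longrightarrow> \<exists>F. finite F \<and> (\<forall>x\<in>cball 0 R. \<exists>y\<in>F. norm (K x - K y) < e)"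
  shows "compact_operator K"
  unfolding compact_operator_def
proof (intro conjI allI impI K)
  fix S :: "'a set" assume "bounded S"
  then obtain R where "\<forall>x\<in>S. norm x \<le> R" unfolding bounded_iff ..
  then have R: "S \<subseteq> cball 0 R" by auto
  show "compact (closure (K ` S))"
    unfolding compact_eq_totally_bounded
  proof (intro conjI allI impI)
    show "complete (closure (K ` S))" by (simp add: complete_eq_closed)
    fix e :: real assume e: "e > 0"
    obtain F where F: "finite F" "\<forall>x\<in>cball 0 R. \<exists>y\<in>F. norm (K x - K y) < e / 2"
      using net[of "e / 2" R] e by auto
    have "K ` S \<subseteq> (\<Union>y\<in>F. cball (K y) (e / 2))"
    proof (rule image_subsetI)
      fix x assume "x \<in> S"
      then obtain y where "y \<in> F" "norm (K x - K y) < e / 2" using F(2) R by blast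
      then show "K x \<in> (\<Union>y\<in>F. cball (K y) (e / 2))"
        by (intro UN_I[of y]) (simp_all add: dist_norm norm_minus_commute)
    qed
    moreover have "closed (\<Union>y\<in>F. cball (K y) (e / 2))" using F(1) by auto
    ultimately have "closure (K ` S) \<subseteq> (\<Union>y\<in>F. cball (K y) (e / 2))"
      by (rule closure_minimal)
    also have "\<dots> \<subseteq> (\<Union>c\<in>K ` F. ball c e)"
    proof
      fix w assume "w \<in> (\<Union>y\<in>F. cball (K y) (e / 2))"
      then obtain y where "y \<in> F" "dist (K y) w \<le> e / 2" by auto
      then show "w \<in> (\<Union>c\<in>K ` F. ball c e)" using e by (intro UN_I[of "K y"]) auto
    qed
    finally show "\<exists>k. finite k \<and> closure (K ` S) \<subseteq> (\<Union>c\<in>k. ball c e)"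
      using F(1) by blast
  qed
qed

text \<open>
  If on bounded sets \<open>S x\<close> is small whenever some compact \<open>K\<close> makes \<open>K x\<close> small, then \<open>S\<close> is compact:
  applied to differences, this turns finite nets for \<open>K\<close> into finite nets for \<open>S\<close>. The
  stability of compactness under norm limits and under the inequalities below follows from it.
\<close>

lemma compact_operator_transfer:
  fixes S :: "'a::chilbert_space \<Rightarrow> 'a"
  assumes S: "bounded_clinear S"
    and small: "\<And>R e. e > 0 \<Longrightarrow> \<exists>K d. d > 0 \<and> compact_operator K \<and>
                  (\<forall>x::'a. norm x \<le> R \<longrightarrow> norm (K x) < d \<longrightarrow> norm (S x) < e)"
  shows "compact_operator S"
proof (rule compact_operatorI[OF S])
  fix R e :: real assume "e > 0"
  then obtain K d where d: "d > 0" and K: "compact_operator K"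
    and KS: "\<And>x::'a. norm x \<le> 2 * R \<Longrightarrow> norm (K x) < d \<Longrightarrow> norm (S x) < e"
    using small[of e "2 * R"] by blast
  obtain F where F: "finite F" "F \<subseteq> cball 0 R"
    "\<And>x. x \<in> cball 0 R \<Longrightarrow> \<exists>y\<in>F. norm (K x - K y) < d"
    using compact_operator_finite_net[OF K d, of R] by blast
  have "\<exists>y\<in>F. norm (S x - S y) < e" if x: "x \<in> cball 0 R" for x
  proof -
    obtain y where y: "y \<in> F" "norm (K x - K y) < d" using F(3)[OF x] by blast
    have "norm x \<le> R" using x by simp
    moreover have "norm y \<le> R" using subsetD[OF F(2) y(1)] by simp
    ultimately have "norm (x - y) \<le> 2 * R" using norm_triangle_ineq4[of x y] by linarith
    then have "norm (S (x - y)) < e"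
      using KS y(2) by (simp add: bounded_clinear_diff[OF compact_operator_bounded_clinear[OF K]])
    then show ?thesis using y(1) by (auto simp: bounded_clinear_diff[OF S])
  qed
  then show "\<exists>F. finite F \<and> (\<forall>x\<in>cball 0 R. \<exists>y\<in>F. norm (S x - S y) < e)"
    using F(1) by blast
qed

lemma compact_operator_compose_left:
  assumes L: "bounded_clinear L" and K: "compact_operator K"
  shows "compact_operator (\<lambda>x. L (K x))"
proof (rule compact_operator_transfer)
  show "bounded_clinear (\<lambda>x. L (K x))"
    by (rule bounded_clinear_compose[OF L compact_operator_bounded_clinear[OF K]])
  fix R e :: real assume "e > 0"
  then obtain d where d: "d > 0" "d * onorm L < e"
    using ex_small_multiple bounded_clinear_onorm_nonneg[OF L] by blast
  have "norm (L (K x)) < e" if "norm (K x) < d" for x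
  proof -
    have "norm (L (K x)) \<le> onorm L * norm (K x)" by (rule bounded_clinear_norm_le[OF L])
    also have "\<dots> \<le> onorm L * d"
      using that bounded_clinear_onorm_nonneg[OF L] by (intro mult_left_mono) auto
    finally show ?thesis using d(2) by (simp add: mult.commute)
  qed
  then show "\<exists>K' d. d > 0 \<and> compact_operator K' \<and>
      (\<forall>x. norm x \<le> R \<longrightarrow> norm (K' x) < d \<longrightarrow> norm (L (K x)) < e)"
    using d(1) K by blast
qed

lemma compact_operator_compose_right:
  assumes K: "compact_operator K" and L: "bounded_clinear L"
  shows "compact_operator (\<lambda>x. K (L x))"
  unfolding compact_operator_def
proof (intro conjI allI impI)
  show "bounded_clinear (\<lambda>x. K (L x))"
    by (rule bounded_clinear_compose[OF compact_operator_bounded_clinear[OF K] L])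
  fix S :: "'a set" assume "bounded S"
  then have "bounded (L ` S)"
    by (rule bounded_linear_image[OF _ bounded_clinear_bounded_linear[OF L]])
  then have "compact (closure (K ` L ` S))" using K unfolding compact_operator_def by blast
  then show "compact (closure ((\<lambda>x. K (L x)) ` S))" by (simp add: image_image)
qed

lemma compact_operator_limit:
  fixes S :: "'a::chilbert_space \<Rightarrow> 'a"
  assumes S: "bounded_clinear S"
    and approx: "\<And>e. e > 0 \<Longrightarrow> \<exists>K. compact_operator K \<and> (\<forall>x. norm (S x - K x) \<le> e * norm x)"
  shows "compact_operator S"
proof (rule compact_operator_transfer[OF S])
  fix R e :: real assume e: "e > 0"
  then obtain d where d: "d > 0" "d * \<bar>R\<bar> < e / 2"
    using ex_small_multiple[of "e / 2" "\<bar>R\<bar>"] by auto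
  obtain K where K: "compact_operator K" "\<And>x. norm (S x - K x) \<le> d * norm x"
    using approx[OF d(1)] by blast
  have "norm (S x) < e" if "norm x \<le> R" "norm (K x) < e / 2" for x
  proof -
    have "d * norm x \<le> d * \<bar>R\<bar>" using that(1) d(1) by (intro mult_left_mono) auto
    then show ?thesis
      using K(2)[of x] d(2) that(2) norm_triangle_ineq2[of "S x" "K x"] by linarith
  qed
  then show "\<exists>K d. d > 0 \<and> compact_operator K \<and>
      (\<forall>x. norm x \<le> R \<longrightarrow> norm (K x) < d \<longrightarrow> norm (S x) < e)"
    using e K(1) by (intro exI[of _ K] exI[of _ "e / 2"]) auto
qed

text \<open>On a bounded set the factor \<open>norm x powr c\<close> is bounded, so a small \<open>K x\<close> forces a small \<open>S x\<close>.\<close>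

lemma compact_operator_interpolation:
  fixes S :: "'a::chilbert_space \<Rightarrow> 'a"
  assumes S: "bounded_clinear S" and K: "compact_operator K" and bc: "b > 0" "c > 0"
    and le: "\<And>x. norm (S x) powr (b + c) \<le> norm (K x) powr b * norm x powr c"
  shows "compact_operator S"
proof (rule compact_operator_transfer[OF S])
  fix R e :: real assume e: "e > 0"
  then obtain d where d: "d > 0" "d * \<bar>R\<bar> powr c < e powr (b + c)"
    using ex_small_multiple[of "e powr (b + c)" "\<bar>R\<bar> powr c"] by auto
  have "norm (S x) < e" if x: "norm x \<le> R" "norm (K x) < d powr (1 / b)" for x
  proof (rule ccontr)
    assume "\<not> norm (S x) < e"
    then have "e powr (b + c) \<le> norm (S x) powr (b + c)" using e bc by (intro powr_mono2) auto
    also have "\<dots> \<le> norm (K x) powr b * norm x powr c" by (rule le)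
    also have "\<dots> \<le> (d powr (1 / b)) powr b * \<bar>R\<bar> powr c"
      using x bc by (intro mult_mono powr_mono2) auto
    also have "\<dots> = d * \<bar>R\<bar> powr c" using d(1) bc by (simp add: powr_powr)
    finally show False using d(2) by simp
  qed
  moreover have "d powr (1 / b) > 0" using d(1) by simp
  ultimately show "\<exists>K d. d > 0 \<and> compact_operator K \<and>
      (\<forall>x. norm x \<le> R \<longrightarrow> norm (K x) < d \<longrightarrow> norm (S x) < e)"
    using K by blast
qed

lemma compact_operator_cadjoint_composeD:
  assumes T: "bounded_clinear T" and K: "compact_operator (\<lambda>x. cadjoint T (T x))"
  shows "compact_operator T"
proof (rule compact_operator_interpolation[OF T K, of 1 1])
  fix x
  have "(norm (T x))\<^sup>2 = inner (cadjoint T (T x)) x"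
    by (simp add: inner_cadjoint_left[OF T] power2_norm_eq_inner)
  also have "\<dots> \<le> norm (cadjoint T (T x)) * norm x" by (rule norm_cauchy_schwarz)
  finally show "norm (T x) powr (1 + 1) \<le> norm (cadjoint T (T x)) powr 1 * norm x powr 1"
    by (simp add: powr_numeral)
qed auto

lemma compact_operator_op_powr_left:
  assumes A: "positive_op A" and L: "bounded_clinear L" and s: "s > 0" and t: "t > 0"
    and K: "compact_operator (\<lambda>x. op_powr A s (L x))"
  shows "compact_operator (\<lambda>x. op_powr A t (L x))"
proof (rule compact_operator_limit)
  show "bounded_clinear (\<lambda>x. op_powr A t (L x))"
    by (rule bounded_clinear_compose[OF bounded_clinear_op_powr[OF A t] L])
  fix e :: real assume "e > 0"
  then obtain d where d: "d > 0" "d * onorm L < e"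
    using ex_small_multiple bounded_clinear_onorm_nonneg[OF L] by blast
  obtain Q where Q: "\<And>x. norm (op_powr A t x - op_poly Q A (op_powr A s x)) \<le> d * norm x"
    using op_powr_approx_multiple[OF A s t d(1)] by blast
  have "norm (op_powr A t (L x) - op_poly Q A (op_powr A s (L x))) \<le> e * norm x" for x
  proof -
    have "norm (op_powr A t (L x) - op_poly Q A (op_powr A s (L x))) \<le> d * norm (L x)" by (rule Q)
    also have "\<dots> \<le> d * (onorm L * norm x)"
      using d(1) by (intro mult_left_mono bounded_clinear_norm_le[OF L]) auto
    also have "\<dots> \<le> e * norm x" using d(2) by (simp add: mult.assoc[symmetric] mult_right_mono)
    finally show ?thesis .
  qed
  moreover have "compact_operator (\<lambda>x. op_poly Q A (op_powr A s (L x)))"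
    by (rule compact_operator_compose_left[OF bounded_clinear_op_poly[OF positive_op_bounded_clinear[OF A]] K])
  ultimately show "\<exists>K. compact_operator K \<and> (\<forall>x. norm (op_powr A t (L x) - K x) \<le> e * norm x)"
    by blast
qed

lemma compact_operator_op_powr_right:
  assumes A: "positive_op A" and L: "bounded_clinear L" and s: "s > 0" and t: "t > 0"
    and K: "compact_operator (\<lambda>x. L (op_powr A s x))"
  shows "compact_operator (\<lambda>x. L (op_powr A t x))"
proof (rule compact_operator_limit)
  show "bounded_clinear (\<lambda>x. L (op_powr A t x))"
    by (rule bounded_clinear_compose[OF L bounded_clinear_op_powr[OF A t]])
  fix e :: real assume "e > 0"
  then obtain d where d: "d > 0" "d * onorm L < e"
    using ex_small_multiple bounded_clinear_onorm_nonneg[OF L] by blast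
  obtain Q where Q: "\<And>x. norm (op_powr A t x - op_poly Q A (op_powr A s x)) \<le> d * norm x"
    using op_powr_approx_multiple[OF A s t d(1)] by blast
  (* The polynomial factor commutes with A^s and is moved to the right, next to the argument. *)
  have "norm (L (op_powr A t x) - L (op_powr A s (op_poly Q A x))) \<le> e * norm x" for x
  proof -
    have "norm (L (op_powr A t x - op_poly Q A (op_powr A s x)))
        \<le> onorm L * norm (op_powr A t x - op_poly Q A (op_powr A s x))"
      by (rule bounded_clinear_norm_le[OF L])
    also have "\<dots> \<le> onorm L * (d * norm x)"
      by (intro mult_left_mono Q bounded_clinear_onorm_nonneg[OF L])
    also have "\<dots> = (d * onorm L) * norm x" by simp
    also have "\<dots> \<le> e * norm x" using d(2) by (intro mult_right_mono) auto
    finally show ?thesis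
      by (simp add: bounded_clinear_diff[OF L] op_powr_op_poly_commute[OF A s])
  qed
  moreover have "compact_operator (\<lambda>x. L (op_powr A s (op_poly Q A x)))"
    by (rule compact_operator_compose_right[OF K bounded_clinear_op_poly[OF positive_op_bounded_clinear[OF A]]])
  ultimately show "\<exists>K. compact_operator K \<and> (\<forall>x. norm (L (op_powr A t x) - K x) \<le> e * norm x)"
    by blast
qed

section \<open>Absolute-(p, r)-paranormal operators\<close>

lemma positive_op_abs: "bounded_clinear T \<Longrightarrow> positive_op (op_abs T)"
  unfolding op_abs_def by (intro positive_op_powr positive_op_cadjoint_compose) auto

text \<open>
  Here \<open>|T|\<close> is itself a power of \<open>T\<^sup>*T\<close>, so a power of \<open>|T|\<close> is exchanged with \<open>T\<^sup>*T\<close> in two steps,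
  through the first power of \<open>|T|\<close>.
\<close>

lemma compact_operator_op_abs_powr_left:
  assumes T: "bounded_clinear T" and L: "bounded_clinear L" and p: "p > 0"
    and K: "compact_operator (\<lambda>x. cadjoint T (T (L x)))"
  shows "compact_operator (\<lambda>x. op_powr (op_abs T) p (L x))"
proof -
  note pos = positive_op_cadjoint_compose[OF T]
  have "compact_operator (\<lambda>x. op_powr (cadjoint T \<circ> T) 1 (L x))"
    using K by (simp add: op_powr_1[OF pos])
  then have "compact_operator (\<lambda>x. op_abs T (L x))"
    unfolding op_abs_def by (rule compact_operator_op_powr_left[OF pos L, rotated 2]) auto
  then have "compact_operator (\<lambda>x. op_powr (op_abs T) 1 (L x))"
    by (simp add: op_powr_1[OF positive_op_abs[OF T]])
  then show ?thesis
    by (rule compact_operator_op_powr_left[OF positive_op_abs[OF T] L, rotated 2]) (auto simp: p)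
qed

lemma compact_operator_op_abs_powr_right:
  assumes T: "bounded_clinear T" and L: "bounded_clinear L" and r: "r > 0"
  shows "compact_operator (\<lambda>x. L (op_powr (op_abs T) r x)) \<longleftrightarrow>
         compact_operator (\<lambda>x. L (cadjoint T (T x)))"
proof -
  note pos = positive_op_cadjoint_compose[OF T]
  have "compact_operator (\<lambda>x. L (op_powr (op_abs T) r x)) \<longleftrightarrow>
        compact_operator (\<lambda>x. L (op_powr (op_abs T) 1 x))"
    using compact_operator_op_powr_right[OF positive_op_abs[OF T] L] r by (meson zero_less_one)
  also have "\<dots> \<longleftrightarrow> compact_operator (\<lambda>x. L (op_powr (cadjoint T \<circ> T) (1 / 2) x))"
    unfolding op_powr_1[OF positive_op_abs[OF T]] by (simp only: op_abs_def)
  also have "\<dots> \<longleftrightarrow> compact_operator (\<lambda>x. L (op_powr (cadjoint T \<circ> T) 1 x))"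
    using compact_operator_op_powr_right[OF pos L] by (meson zero_less_one half_gt_zero)
  also have "\<dots> \<longleftrightarrow> compact_operator (\<lambda>x. L (cadjoint T (T x)))"
    by (simp add: op_powr_1[OF pos])
  finally show ?thesis .
qed

text \<open>
  Both sides are homogeneous of degree \<open>p + r\<close>; the homogeneous form can be applied to differences
  of points, which are not unit vectors.
\<close>

lemma absolute_paranormal_homogeneous:
  assumes T: "bounded_clinear T" and p: "p > 0" and r: "r > 0"
    and para: "absolute_paranormal p r T"
  defines "W \<equiv> op_powr (op_abs T) p" and "D \<equiv> op_powr (op_abs (cadjoint T)) r"
  shows "norm (D x) powr (r + p) \<le> norm (W (D x)) powr r * norm x powr p"
proof (cases "x = 0")
  case True
  have "bounded_clinear D"
    unfolding D_def by (intro bounded_clinear_op_powr positive_op_abs bounded_clinear_cadjoint T r)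
  then show ?thesis using True by (simp add: bounded_clinear_zero)
next
  case False
  define n where "n = norm x"
  have n: "n > 0" using False by (simp add: n_def)
  have linD: "bounded_clinear D" and linW: "bounded_clinear W"
    unfolding D_def W_def
    by (intro bounded_clinear_op_powr positive_op_abs bounded_clinear_cadjoint T p r)+
  have scale: "D (inverse n *\<^sub>R x) = inverse n *\<^sub>R D x" "W (inverse n *\<^sub>R y) = inverse n *\<^sub>R W y" for y
    by (simp_all add: scaleR_scaleC bounded_clinear_scaleC[OF linD] bounded_clinear_scaleC[OF linW])
  have "norm (inverse n *\<^sub>R x) = 1" using n by (simp add: n_def)
  then have "norm (D (inverse n *\<^sub>R x)) powr (p + r) \<le> norm (W (D (inverse n *\<^sub>R x))) powr r"
    using para unfolding absolute_paranormal_def D_def W_def by blast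
  then have "(norm (D x) / n) powr (p + r) \<le> (norm (W (D x)) / n) powr r"
    using n by (simp add: scale divide_inverse mult.commute)
  then have "norm (D x) powr (p + r) / n powr (p + r) \<le> norm (W (D x)) powr r / n powr r"
    using n by (simp add: powr_divide)
  then have "norm (D x) powr (p + r) \<le> norm (W (D x)) powr r / n powr r * n powr (p + r)"
    using n by (simp add: pos_divide_le_eq)
  also have "\<dots> = norm (W (D x)) powr r * n powr p"
    using n by (simp add: powr_add)
  finally show ?thesis by (simp add: n_def add.commute)
qed

theorem theorem4p5:
  fixes T :: "'a::chilbert_space \<Rightarrow> 'a" and p r :: real
  assumes "bounded_clinear T"
    and "p > 0" and "r > 0"
    and "absolute_paranormal p r T"
    and "compact_operator (T \<circ> T)"
  shows "compact_operator T"
proof -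
  note T = assms(1)
  note T' = bounded_clinear_cadjoint[OF T]
  let ?W = "op_powr (op_abs T) p" and ?D = "op_powr (op_abs (cadjoint T)) r"
  have linW: "bounded_clinear ?W" and linD: "bounded_clinear ?D"
    using assms(2,3) by (intro bounded_clinear_op_powr positive_op_abs T T'; simp)+
  have "compact_operator (\<lambda>x. cadjoint T ((T \<circ> T) (cadjoint T x)))"
    by (intro compact_operator_compose_left[OF T'] compact_operator_compose_right[OF _ T'] assms(5))
  then have "compact_operator (\<lambda>x. cadjoint T (T (T (cadjoint T x))))" by simp
  then have "compact_operator (\<lambda>x. ?W (T (cadjoint T x)))"
    by (rule compact_operator_op_abs_powr_left[OF T bounded_clinear_compose[OF T T'] assms(2)])
  then have "compact_operator (\<lambda>x. ?W (?D x))"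
    by (simp add: compact_operator_op_abs_powr_right[OF T' linW assms(3)] cadjoint_cadjoint[OF T])
  then have "compact_operator ?D"
    using absolute_paranormal_homogeneous[OF assms(1-4)] assms(2,3)
    by (intro compact_operator_interpolation[OF linD, of "\<lambda>x. ?W (?D x)" r p])
  then have "compact_operator (\<lambda>x. cadjoint (cadjoint T) (cadjoint T x))"
    using compact_operator_op_abs_powr_right[OF T' bounded_clinear_id assms(3)] by simp
  then have "compact_operator (cadjoint T)"
    by (rule compact_operator_cadjoint_composeD[OF T'])
  then have "compact_operator (\<lambda>x. cadjoint T (T x))"
    by (rule compact_operator_compose_right[OF _ T])
  then show "compact_operator T"
    by (rule compact_operator_cadjoint_composeD[OF T])
qed

end
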